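(* Let $n\in\mathbb N$ and $s>0$. The set $\mathbb G^n_s$ contains an open and dense set in $\mathbb B^n_s$ (with respect to the topology of the norm $\|\cdot\|_s$).
   Context: $\mathbb T^n=\mathbb R^n/(2\pi\mathbb Z^n)$; $|k|_1=\sum|k_j|$. $\mathbb B^n_s$ is the closed unit ball, with respect to the norm $\|f\|_s:=\sup_{k\in\mathbb Z^n}|f_k|e^{|k|_1s}$, of the Banach space of zero-average real analytic periodic functions $f=\sum_{k\in\mathbb Z^n}f_ke^{ik\cdot x}$ on $\mathbb T^n$ with finite $\|\cdot\|_s$ norm. $\mathcal G^n$ is the set of $k\in\mathbb Z^n\setminus\{0\}$ whose first non-null component is positive and with $\gcd(k_1,\dots,k_n)=1$. For $k\in\mathcal G^n$, $\pi_{\mathbb Zk}f(\theta):=\sum_{j\in\mathbb Z}f_{jk}e^{ij\theta}$, $\theta\in\mathbb T$. $\mathbb G^n_s$ is the set of $f\in\mathbb B^n_s$ such that $\liminf_{|k|_1\to+\infty,\ k\in\mathcal G^n}|f_k|e^{|k|_1s}|k|_1^n>0$ and, for every $k\in\mathcal G^n$, $\pi_{\mathbb Zk}f$ is a Morse function with distinct critical values (all critical points are non-degenerate and distinct critical points have distinct values). *)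

theory Defs
  imports "HOL-Analysis.Analysis"
begin

text \<open>
  The dimension \<open>n \<ge> 1\<close> is the cardinality of the index type \<open>'n\<close>.  A function on the torus is
  represented by its lift to the whole space, periodic with period \<open>2 * pi\<close> in each coordinate.
\<close>

definition torus_periodic :: "(real ^ 'n \<Rightarrow> real) \<Rightarrow> bool" where
  "torus_periodic f \<longleftrightarrow>
     (\<forall>x. \<forall>m :: int ^ 'n. f (x + (\<chi> j. 2 * pi * of_int (m $ j))) = f x)"

definition torus_cell :: "(real ^ 'n) set" where
  "torus_cell = cbox 0 (\<chi> j. 2 * pi)"

text \<open>
  Around every point, \<open>f\<close> is the sum of an (unconditionally) convergent power series in several
  variables; the multi-indices are the functions \<open>\<alpha> :: 'n \<Rightarrow> nat\<close>.
\<close>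

definition real_analytic :: "(real ^ 'n \<Rightarrow> real) \<Rightarrow> bool" where
  "real_analytic f \<longleftrightarrow>
     (\<forall>x. \<exists>r>0. \<exists>a :: ('n \<Rightarrow> nat) \<Rightarrow> real.
        \<forall>h. (\<forall>j. \<bar>h $ j\<bar> < r) \<longrightarrow>
          ((\<lambda>\<alpha>. a \<alpha> * (\<Prod>j\<in>UNIV. (h $ j) ^ \<alpha> j)) has_sum f (x + h)) UNIV)"

definition l1norm :: "int ^ 'n \<Rightarrow> int" where
  "l1norm k = (\<Sum>j\<in>UNIV. \<bar>k $ j\<bar>)"

definition phase :: "int ^ 'n \<Rightarrow> real ^ 'n \<Rightarrow> complex" where
  "phase k x = exp (\<i> * of_real (\<Sum>j\<in>UNIV. of_int (k $ j) * x $ j))"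

definition fourier_coeff :: "(real ^ 'n \<Rightarrow> real) \<Rightarrow> int ^ 'n \<Rightarrow> complex" where
  "fourier_coeff f k =
     integral torus_cell (\<lambda>x. complex_of_real (f x) * phase (- k) x) / (2 * pi) ^ CARD('n)"

text \<open>
  The supremum defining \<open>\<parallel>f\<parallel>\<^sub>s\<close> is taken in \<^typ>\<open>ennreal\<close>, so that it is meaningful for every \<open>f\<close>
  and may be infinite.
\<close>

definition fourier_norm :: "real \<Rightarrow> (real ^ 'n \<Rightarrow> real) \<Rightarrow> ennreal" where
  "fourier_norm s f =
     (SUP k. ennreal (cmod (fourier_coeff f k) * exp (of_int (l1norm k) * s)))"

definition analytic_space :: "real \<Rightarrow> (real ^ 'n \<Rightarrow> real) set" where
  "analytic_space s =
     {f. torus_periodic f \<and> real_analytic f \<and> integral torus_cell f = 0 \<and>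
         (\<forall>x. ((\<lambda>k. fourier_coeff f k * phase k x) has_sum complex_of_real (f x)) UNIV) \<and>
         fourier_norm s f < \<infinity>}"

definition fourier_dist :: "real \<Rightarrow> (real ^ 'n \<Rightarrow> real) \<Rightarrow> (real ^ 'n \<Rightarrow> real) \<Rightarrow> real" where
  "fourier_dist s f g = enn2real (fourier_norm s (\<lambda>x. f x - g x))"

text \<open>That this is a metric on \<open>analytic_space s\<close> is proved at the end of the theory.\<close>

definition norm_topology :: "real \<Rightarrow> (real ^ 'n \<Rightarrow> real) topology" where
  "norm_topology s = Metric_space.mtopology (analytic_space s) (fourier_dist s)"

definition unit_ball :: "real \<Rightarrow> (real ^ 'n \<Rightarrow> real) set" where
  "unit_ball s = {f \<in> analytic_space s. fourier_norm s f \<le> 1}"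

text \<open>
  The linear order on the index type only serves to say which component comes first.
\<close>

definition generators :: "(int ^ 'n :: {finite, linorder}) set" where
  "generators =
     {k. k \<noteq> 0 \<and> (\<exists>j. k $ j > 0 \<and> (\<forall>i<j. k $ i = 0)) \<and> Gcd (range (\<lambda>j. k $ j)) = 1}"

text \<open>
  For real \<open>f\<close> the series is real-valued, so that taking the real part
  only changes the type (lemma \<open>of_real_ray_projection\<close> below).
\<close>

definition ray_projection :: "(real ^ 'n \<Rightarrow> real) \<Rightarrow> int ^ 'n \<Rightarrow> real \<Rightarrow> real" where
  "ray_projection f k \<theta> =
     Re (\<Sum>\<^sub>\<infinity>j::int. fourier_coeff f (\<chi> i. j * k $ i) * exp (\<i> * of_int j * of_real \<theta>))"

text \<open>
  A function on the circle is given by its periodic lift, and two real numbers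
  represent the same point of the circle iff they differ by a multiple of \<open>2 * pi\<close>.
  The definition is meant for smooth \<open>F\<close>; the projections of elements of \<open>analytic_space s\<close> are
  real analytic for \<open>s > 0\<close>, since their coefficients decay exponentially.
\<close>

definition critical_point :: "(real \<Rightarrow> real) \<Rightarrow> real \<Rightarrow> bool" where
  "critical_point F \<theta> \<longleftrightarrow> deriv F \<theta> = 0"

definition morse_distinct_values :: "(real \<Rightarrow> real) \<Rightarrow> bool" where
  "morse_distinct_values F \<longleftrightarrow>
     (\<forall>\<theta>. critical_point F \<theta> \<longrightarrow> deriv (deriv F) \<theta> \<noteq> 0) \<and>
     (\<forall>\<theta> \<theta>'. critical_point F \<theta> \<and> critical_point F \<theta>' \<and>
        (\<nexists>m::int. \<theta>' = \<theta> + 2 * pi * of_int m) \<longrightarrow> F \<theta> \<noteq> F \<theta>')"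

text \<open>
  The filter describes \<open>l1norm k \<rightarrow> \<infinity>\<close> along \<open>k \<in> generators\<close>.  If \<open>CARD('n) = 1\<close> there is only one
  generator, the filter is trivial, and the lower limit is \<open>\<infinity>\<close> by convention.
\<close>

definition generic_set :: "real \<Rightarrow> (real ^ 'n :: {finite, linorder} \<Rightarrow> real) set" where
  "generic_set s =
     {f \<in> unit_ball s.
        Liminf (inf (filtercomap l1norm at_top) (principal generators))
          (\<lambda>k. ereal (cmod (fourier_coeff f k) * exp (of_int (l1norm k) * s)
                       * of_int (l1norm k) ^ CARD('n))) > 0 \<and>
        (\<forall>k\<in>generators. morse_distinct_values (ray_projection f k))}"


lemma phase_neg: "phase (- k) x = cnj (phase k x)"
  by (simp add: phase_def exp_cnj sum_negf)

lemma fourier_coeff_neg: "fourier_coeff f (- k) = cnj (fourier_coeff f k)"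
  by (simp add: fourier_coeff_def phase_neg integral_cnj)

lemma of_real_ray_projection:
  "complex_of_real (ray_projection f k \<theta>) =
     (\<Sum>\<^sub>\<infinity>j::int. fourier_coeff f (\<chi> i. j * k $ i) * exp (\<i> * of_int j * of_real \<theta>))"
proof -
  define t where "t j = fourier_coeff f (\<chi> i. j * k $ i) * exp (\<i> * of_int j * of_real \<theta>)"
    for j :: int
  have neg: "t (- j) = cnj (t j)" for j
  proof -
    have "(\<chi> i. - j * k $ i) = - (\<chi> i. j * k $ i)"
      by (simp add: vec_eq_iff)
    then show ?thesis
      by (simp add: t_def fourier_coeff_neg exp_cnj)
  qed
  have "infsum t UNIV = (\<Sum>\<^sub>\<infinity>j. t (- j))"
    by (rule infsum_reindex_bij_betw [symmetric]) (simp add: bij_uminus)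
  also have "\<dots> = cnj (infsum t UNIV)"
    by (simp add: neg)
  finally have "complex_of_real (Re (infsum t UNIV)) = infsum t UNIV"
    by (simp add: complex_eq_iff)
  then show ?thesis
    by (simp add: ray_projection_def t_def [abs_def])
qed

lemma real_analytic_imp_continuous:
  fixes f :: "real ^ 'n \<Rightarrow> real"
  assumes "real_analytic f"
  shows "continuous_on UNIV f"
proof -
  have "isCont f x" for x
  proof -
    obtain r and a :: "('n \<Rightarrow> nat) \<Rightarrow> real" where r: "r > 0" and
      a: "\<And>h. (\<forall>j. \<bar>h $ j\<bar> < r) \<Longrightarrow>
            ((\<lambda>\<alpha>. a \<alpha> * (\<Prod>j\<in>UNIV. (h $ j) ^ \<alpha> j)) has_sum f (x + h)) UNIV"
      using assms unfolding real_analytic_def by meson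
    define Y where "Y = ball (0 :: real ^ 'n) (r/2)"
    define M where "M \<alpha> = \<bar>a \<alpha> * (\<Prod>j\<in>(UNIV::'n set). (r/2) ^ \<alpha> j)\<bar>" for \<alpha>
    have "(\<lambda>\<alpha>. a \<alpha> * (\<Prod>j\<in>UNIV. ((\<chi> j. r/2) $ j) ^ \<alpha> j)) summable_on UNIV"
      using a[of "\<chi> j. r/2"] r by (auto simp: summable_on_def)
    then have M: "M summable_on UNIV"
      using summable_on_iff_abs_summable_on_real [THEN iffD1]
      unfolding M_def [abs_def] real_norm_def by fastforce
    have Y: "\<bar>h $ j\<bar> \<le> r/2" if "h \<in> Y" for h j
      using that component_le_norm_cart[of h j] by (simp add: Y_def)
    have bound: "norm (a \<alpha> * (\<Prod>j\<in>UNIV. (h $ j) ^ \<alpha> j)) \<le> M \<alpha>" if "h \<in> Y" for \<alpha> h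
    proof -
      have "\<bar>\<Prod>j\<in>UNIV. (h $ j) ^ \<alpha> j\<bar> \<le> (\<Prod>j\<in>(UNIV::'n set). (r/2) ^ \<alpha> j)"
        unfolding abs_prod by (rule prod_mono) (auto simp: power_abs intro!: power_mono Y that)
      then show ?thesis
        unfolding M_def real_norm_def abs_mult
        by (intro mult_left_mono) (auto intro: order_trans)
    qed
    have hs: "((\<lambda>\<alpha>. a \<alpha> * (\<Prod>j\<in>UNIV. (h $ j) ^ \<alpha> j)) has_sum f (x + h)) UNIV"
      if "h \<in> Y" for h
      using a[of h] Y[OF that] r by (fastforce intro: le_less_trans [of _ "r/2"])
    have "uniform_limit Y (\<lambda>X h. \<Sum>\<alpha>\<in>X. a \<alpha> * (\<Prod>j\<in>UNIV. (h $ j) ^ \<alpha> j))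
            (\<lambda>h. f (x + h)) (finite_subsets_at_top UNIV)"
      by (rule Weierstrass_m_test_general'[OF _ hs M]) (rule bound)
    then have "continuous_on Y (\<lambda>h. f (x + h))"
      by (rule uniform_limit_theorem[rotated])
         (auto intro!: always_eventually continuous_intros)
    then have "isCont (\<lambda>h. f (x + h)) 0"
      using r by (simp add: Y_def continuous_on_eq_continuous_at)
    then show ?thesis
      using isCont_o2[of x "\<lambda>y. y - x" "\<lambda>h. f (x + h)"] by simp
  qed
  then show ?thesis
    by (simp add: continuous_on_eq_continuous_at)
qed

lemma fourier_integrable:
  assumes "f \<in> analytic_space s"
  shows "(\<lambda>x. complex_of_real (f x) * phase k x) integrable_on torus_cell"
proof -
  have "continuous_on UNIV f"
    using assms real_analytic_imp_continuous by (auto simp: analytic_space_def)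
  then have "continuous_on torus_cell f"
    using continuous_on_subset by blast
  then show ?thesis
    unfolding torus_cell_def phase_def
    by (intro integrable_continuous continuous_intros)
qed

lemma fourier_coeff_diff:
  assumes "f \<in> analytic_space s" "g \<in> analytic_space s"
  shows "fourier_coeff (\<lambda>x. f x - g x) k = fourier_coeff f k - fourier_coeff g k"
  using assms
  by (simp add: fourier_coeff_def left_diff_distrib integral_diff[OF fourier_integrable fourier_integrable]
      diff_divide_distrib)

lemma fourier_norm_triangle:
  fixes f g h :: "real ^ 'n \<Rightarrow> real"
  assumes "\<And>k. cmod (fourier_coeff h k) \<le> cmod (fourier_coeff f k) + cmod (fourier_coeff g k)"
  shows "fourier_norm s h \<le> fourier_norm s f + fourier_norm s g"
  unfolding fourier_norm_def
proof (rule SUP_least)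
  fix k :: "int ^ 'n"
  let ?w = "exp (of_int (l1norm k) * s)"
  have "ennreal (cmod (fourier_coeff h k) * ?w)
      \<le> ennreal (cmod (fourier_coeff f k) * ?w + cmod (fourier_coeff g k) * ?w)"
    by (rule ennreal_leI) (simp add: assms flip: distrib_right)
  also have "\<dots> = ennreal (cmod (fourier_coeff f k) * ?w) + ennreal (cmod (fourier_coeff g k) * ?w)"
    by simp
  also have "\<dots> \<le> (SUP k. ennreal (cmod (fourier_coeff f k) * exp (of_int (l1norm k) * s)))
              + (SUP k. ennreal (cmod (fourier_coeff g k) * exp (of_int (l1norm k) * s)))"
    by (intro add_mono SUP_upper) auto
  finally show "ennreal (cmod (fourier_coeff h k) * ?w) \<le> \<dots>" .
qed

lemma fourier_norm_diff_finite:
  assumes "f \<in> analytic_space s" "g \<in> analytic_space s"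
  shows "fourier_norm s (\<lambda>x. f x - g x) < \<infinity>"
proof -
  have "fourier_norm s (\<lambda>x. f x - g x) \<le> fourier_norm s f + fourier_norm s g"
    by (rule fourier_norm_triangle) (simp add: fourier_coeff_diff[OF assms] norm_triangle_ineq4)
  also have "\<dots> < \<infinity>"
    using assms by (simp add: analytic_space_def)
  finally show ?thesis .
qed

lemma Metric_space_analytic_space: "Metric_space (analytic_space s) (fourier_dist s)"
proof
  fix f g :: "real ^ 'n \<Rightarrow> real"
  show "0 \<le> fourier_dist s f g"
    by (simp add: fourier_dist_def)
  have "fourier_coeff (\<lambda>x. f x - g x) k = - fourier_coeff (\<lambda>x. g x - f x) k" for k
  proof -
    have "(\<lambda>x. complex_of_real (f x - g x) * phase (- k) x)
        = (\<lambda>x. - (complex_of_real (g x - f x) * phase (- k) x))"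
      by (simp add: algebra_simps fun_eq_iff)
    then show ?thesis
      by (simp only: fourier_coeff_def integral_neg minus_divide_left)
  qed
  then show "fourier_dist s f g = fourier_dist s g f"
    by (simp add: fourier_dist_def fourier_norm_def)
next
  fix f g :: "real ^ 'n \<Rightarrow> real"
  assume fg: "f \<in> analytic_space s" "g \<in> analytic_space s"
  show "fourier_dist s f g = 0 \<longleftrightarrow> f = g"
  proof
    assume "fourier_dist s f g = 0"
    then have "fourier_norm s (\<lambda>x. f x - g x) = 0"
      using fourier_norm_diff_finite[OF fg] by (auto simp: fourier_dist_def enn2real_eq_0_iff)
    then have "cmod (fourier_coeff f k - fourier_coeff g k) * exp (of_int (l1norm k) * s) \<le> 0" for k
      unfolding fourier_norm_def fourier_coeff_diff[OF fg]
      by (simp add: bot_ennreal[symmetric] SUP_bot_conv) (simp add: bot_ennreal ennreal_eq_0_iff)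
    then have "fourier_coeff f k = fourier_coeff g k" for k
      by (simp add: mult_le_0_iff not_le)
    then have eq: "fourier_coeff f = fourier_coeff g" by (rule ext)
    have "complex_of_real (f x) = complex_of_real (g x)" for x
    proof (rule has_sum_unique)
      show "((\<lambda>k. fourier_coeff f k * phase k x) has_sum complex_of_real (f x)) UNIV"
        using fg unfolding analytic_space_def by blast
      show "((\<lambda>k. fourier_coeff f k * phase k x) has_sum complex_of_real (g x)) UNIV"
        using fg unfolding eq analytic_space_def by blast
    qed
    then show "f = g" by auto
  next
    assume "f = g"
    then show "fourier_dist s f g = 0"
      by (simp add: fourier_dist_def fourier_norm_def fourier_coeff_def)
  qed
next
  fix f g h :: "real ^ 'n \<Rightarrow> real"
  assume fgh: "f \<in> analytic_space s" "g \<in> analytic_space s" "h \<in> analytic_space s"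
  have "fourier_norm s (\<lambda>x. f x - h x)
      \<le> fourier_norm s (\<lambda>x. f x - g x) + fourier_norm s (\<lambda>x. g x - h x)"
    by (rule fourier_norm_triangle)
       (simp add: fourier_coeff_diff[OF fgh(1,2)] fourier_coeff_diff[OF fgh(2,3)]
          fourier_coeff_diff[OF fgh(1,3)],
        metis dist_complex_def dist_triangle)
  then have "fourier_dist s f h
      \<le> enn2real (fourier_norm s (\<lambda>x. f x - g x) + fourier_norm s (\<lambda>x. g x - h x))"
    unfolding fourier_dist_def
    by (rule enn2real_mono)
       (use fourier_norm_diff_finite[OF fgh(1,2)] fourier_norm_diff_finite[OF fgh(2,3)] in simp)
  also have "\<dots> = fourier_dist s f g + fourier_dist s g h"
    using fourier_norm_diff_finite[OF fgh(1,2)] fourier_norm_diff_finite[OF fgh(2,3)]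
    by (simp add: fourier_dist_def enn2real_plus)
  finally show "fourier_dist s f h \<le> fourier_dist s f g + fourier_dist s g h" .
qed

end

theory Submission
  imports Defs
begin

text \<open>
  Put \<open>a\<^sub>k = f\<^sub>k exp (s |k|)\<close>.  In these coordinates the norm is a supremum norm, and the unit ball consists of
  all families with \<open>|a\<^sub>k| \<le> 1\<close>, \<open>a\<^sub>0 = 0\<close> and \<open>a\<^sub>-\<^sub>k\<close> conjugate to \<open>a\<^sub>k\<close>
  (\<open>fourier_synthesis_in_analytic_space\<close>, \<open>fourier_coeff_fourier_synthesis\<close>).  For \<open>n \<ge> 2\<close> the
  lower limit condition of \<open>generic_set\<close> is not open: it allows \<open>a\<^sub>k\<close> to tend to zero along the
  generators, and then a uniformly small change can make infinitely many of these coefficients vanish.  The open set is therefore \<open>robust_set\<close>, on which \<open>|a\<^sub>k|\<close> is bounded below uniformly over the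
  generators.

  Openness.  On the ray through a generator \<open>k\<close>, the \<open>j\<close>-th harmonic has size at most
  \<open>exp (- j s |k|)\<close>, whereas the first one has size at least \<open>\<delta> exp (- s |k|)\<close>.  Hence for large \<open>|k|\<close> the
  projection is, after a shift and a rescaling, a small \<open>C\<^sup>2\<close> perturbation of the cosine, and it is a
  Morse function with distinct critical values, uniformly for all functions with the same lower bound
  (\<open>morse_wave_series_dominant\<close>).  Only finitely many rays remain, and for each of them the
  property is \<open>C\<^sup>2\<close>-stable (\<open>morse_distinct_values_stable\<close>).

  Density.  Every element of \<open>generators\<close> lies on its own ray, so that the coefficients at the
  generators can be adjusted independently.  First the function is shrunk, to gain room
  inside the ball.  Then, for every generator, a small change of the single coefficient
  \<open>f\<^sub>k\<close> is enough: it adds a multiple \<open>Re (w exp (i \<theta>))\<close> of the first harmonic to the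
  projection \<open>F\<close>.  The \<open>w\<close> that leave a degenerate critical point form the curve
  \<open>(F'' + i F') exp (- i \<theta>)\<close>, a null set in the plane.  If \<open>F\<close> is already nondegenerate, then adding
  \<open>t cos (\<theta> - p)\<close> moves each critical value at the rate \<open>cos (a - p)\<close>, where \<open>a\<close> is the
  critical point; for all but countably many \<open>p\<close> these rates differ from each other, and coinciding
  critical values separate (\<open>morse_distinct_values_by_wave\<close>).
\<close>


section \<open>Morse functions on the circle: stability and perturbation\<close>

text \<open>
  The derivatives are carried along as explicit functions, so that closeness in \<open>C\<^sup>2\<close> can be stated
  without \<^const>\<open>deriv\<close>.
\<close>

definition c2_circle :: "(real \<Rightarrow> real) \<Rightarrow> (real \<Rightarrow> real) \<Rightarrow> (real \<Rightarrow> real) \<Rightarrow> bool" where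
  "c2_circle F F1 F2 \<longleftrightarrow>
     (\<forall>x. (F has_real_derivative F1 x) (at x)) \<and>
     (\<forall>x. (F1 has_real_derivative F2 x) (at x)) \<and>
     continuous_on UNIV F2 \<and>
     (\<forall>x (m::int). F (x + 2 * pi * m) = F x \<and> F1 (x + 2 * pi * m) = F1 x \<and>
        F2 (x + 2 * pi * m) = F2 x)"

definition same_angle :: "real \<Rightarrow> real \<Rightarrow> bool" where
  "same_angle x y \<longleftrightarrow> (\<exists>m::int. y = x + 2 * pi * of_int m)"

definition nondegenerate :: "(real \<Rightarrow> real) \<Rightarrow> (real \<Rightarrow> real) \<Rightarrow> bool" where
  "nondegenerate F1 F2 \<longleftrightarrow> (\<forall>x. F1 x = 0 \<longrightarrow> F2 x \<noteq> 0)"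

lemma morse_distinct_values_iff:
  assumes "c2_circle F F1 F2"
  shows "morse_distinct_values F \<longleftrightarrow> nondegenerate F1 F2 \<and>
     (\<forall>x y. F1 x = 0 \<and> F1 y = 0 \<and> \<not> same_angle x y \<longrightarrow> F x \<noteq> F y)"
proof -
  have "deriv F = F1" "deriv F1 = F2"
    using assms by (auto simp: c2_circle_def intro!: ext DERIV_imp_deriv)
  then show ?thesis
    by (simp add: morse_distinct_values_def critical_point_def nondegenerate_def same_angle_def)
qed

lemma c2_circle_continuous:
  assumes "c2_circle F F1 F2"
  shows "isCont F x" "isCont F1 x" "isCont F2 x"
  using assms unfolding c2_circle_def
  by (auto intro: DERIV_isCont simp: continuous_on_eq_continuous_at)

lemma c2_circle_derivs:
  assumes "c2_circle F F1 F2"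
  shows "(F has_real_derivative F1 x) (at x)" "(F1 has_real_derivative F2 x) (at x)"
  using assms unfolding c2_circle_def by auto

lemma c2_circle_periodic:
  assumes "c2_circle F F1 F2"
  shows "F (x + 2 * pi * of_int m) = F x" "F1 (x + 2 * pi * of_int m) = F1 x"
    "F2 (x + 2 * pi * of_int m) = F2 x"
  using assms unfolding c2_circle_def by auto

lemma angle_representative:
  obtains m :: int where "x + 2 * pi * of_int m \<in> {0..2 * pi}"
proof
  define m where "m = \<lfloor>x / (2 * pi)\<rfloor>"
  have "of_int m \<le> x / (2 * pi)" "x / (2 * pi) \<le> of_int m + 1"
    unfolding m_def by linarith+
  then show "x + 2 * pi * of_int (- m) \<in> {0..2 * pi}"
    by (simp add: field_simps)
qed

lemma mean_value_near:
  fixes f :: "real \<Rightarrow> real"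
  assumes "\<And>x. (f has_real_derivative f' x) (at x)"
  shows "\<exists>z. \<bar>z - a\<bar> \<le> \<bar>x - a\<bar> \<and> f x - f a = (x - a) * f' z"
proof (cases x a rule: linorder_cases)
  case less
  then obtain z where "x < z" "z < a" "f a - f x = (a - x) * f' z"
    using MVT2[of x a f f'] assms by auto
  then show ?thesis using less by (intro exI[of _ z]) (auto simp: algebra_simps)
next
  case equal then show ?thesis by (intro exI[of _ a]) auto
next
  case greater
  then obtain z where "a < z" "z < x" "f x - f a = (x - a) * f' z"
    using MVT2[of a x f f'] assms by auto
  then show ?thesis by (intro exI[of _ z]) auto
qed

lemma tendsto_near:
  fixes z :: "nat \<Rightarrow> real"
  assumes "x \<longlonglongrightarrow> a" "\<And>n. \<bar>z n - a\<bar> \<le> \<bar>x n - a\<bar>"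
  shows "z \<longlonglongrightarrow> a"
proof -
  have "(\<lambda>n. \<bar>x n - a\<bar>) \<longlonglongrightarrow> 0"
    using assms(1) by (simp add: LIM_zero tendsto_rabs_zero)
  then have "(\<lambda>n. z n - a) \<longlonglongrightarrow> 0"
    by (rule Lim_null_comparison[rotated]) (simp add: assms(2))
  then show ?thesis by (rule LIM_zero_cancel)
qed

lemma zeros_of_nearby_functions:
  fixes F :: "real \<Rightarrow> real"
  assumes "isCont F a" "x \<longlonglongrightarrow> a" "\<And>n. \<bar>G n (x n) - F (x n)\<bar> \<le> e n" "e \<longlonglongrightarrow> 0"
    "\<And>n. G n (x n) = 0"
  shows "F a = 0"
proof -
  have "(\<lambda>n. F (x n)) \<longlonglongrightarrow> F a"
    using assms(1,2) by (rule isCont_tendsto_compose)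
  moreover have "(\<lambda>n. F (x n)) \<longlonglongrightarrow> 0"
    by (rule Lim_null_comparison[OF _ assms(4)]) (use assms(3,5) in simp)
  ultimately show ?thesis by (rule LIMSEQ_unique)
qed

text \<open>
  Rolle's theorem puts a zero of \<open>G2 n\<close> between two different critical points; if they merge in the limit,
  the limit point is degenerate.
\<close>

lemma coalescing_critical_points:
  assumes G: "\<And>n z. (G1 n has_real_derivative G2 n z) (at z)"
    and close: "\<And>n z. \<bar>G2 n z - F2 z\<bar> \<le> e n" and e: "e \<longlonglongrightarrow> 0"
    and F2: "isCont F2 a"
    and x: "x \<longlonglongrightarrow> a" and y: "y \<longlonglongrightarrow> a" and ne: "\<And>n. x n \<noteq> y n"
    and zero: "\<And>n. G1 n (x n) = 0" "\<And>n. G1 n (y n) = 0"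
  shows "F2 a = 0"
proof -
  have "\<exists>z. \<bar>z - y n\<bar> \<le> \<bar>x n - y n\<bar> \<and> G2 n z = 0" for n
    using mean_value_near[OF G, of "y n" "x n" n] zero ne[of n] by auto
  then obtain z where z: "\<And>n. \<bar>z n - y n\<bar> \<le> \<bar>x n - y n\<bar>" "\<And>n. G2 n (z n) = 0"
    by metis
  have "(\<lambda>n. \<bar>x n - y n\<bar>) \<longlonglongrightarrow> \<bar>a - a\<bar>"
    by (intro tendsto_intros x y)
  then have "(\<lambda>n. z n - y n) \<longlonglongrightarrow> 0"
    by (intro Lim_null_comparison[of "\<lambda>n. z n - y n" "\<lambda>n. \<bar>x n - y n\<bar>"]) (auto simp: z)
  then have "(\<lambda>n. (z n - y n) + y n) \<longlonglongrightarrow> 0 + a"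
    by (intro tendsto_add y)
  then have "z \<longlonglongrightarrow> a" by simp
  then show ?thesis
    using zeros_of_nearby_functions[where F = F2 and G = G2 and x = z and e = e] F2 close e z(2)
    by blast
qed

text \<open>
  A sequence of counterexamples has degenerate points in one period, and by compactness these accumulate at a
  degenerate critical point of the limit function.
\<close>

lemma nondegenerate_stable:
  assumes F: "c2_circle F F1 F2" and nd: "nondegenerate F1 F2"
  shows "\<exists>e>0. \<forall>G G1 G2. c2_circle G G1 G2 \<longrightarrow>
           (\<forall>x. \<bar>G1 x - F1 x\<bar> < e \<and> \<bar>G2 x - F2 x\<bar> < e) \<longrightarrow> nondegenerate G1 G2"
proof (rule ccontr)
  assume neg: "\<not> ?thesis"
  define e where "e n = inverse (real (Suc n))" for n
  have e: "e \<longlonglongrightarrow> 0" unfolding e_def by (rule LIMSEQ_inverse_real_of_nat)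
  have "\<exists>G G1 G2 x. c2_circle G G1 G2 \<and> (\<forall>x. \<bar>G1 x - F1 x\<bar> < e n \<and> \<bar>G2 x - F2 x\<bar> < e n)
          \<and> G1 x = 0 \<and> G2 x = 0 \<and> x \<in> {0..2 * pi}" for n
  proof -
    have "e n > 0" by (simp add: e_def)
    then obtain G G1 G2 x where G: "c2_circle G G1 G2"
      "\<forall>x. \<bar>G1 x - F1 x\<bar> < e n \<and> \<bar>G2 x - F2 x\<bar> < e n" "G1 x = 0" "G2 x = 0"
      using neg unfolding nondegenerate_def by blast
    obtain m :: int where "x + 2 * pi * of_int m \<in> {0..2 * pi}"
      by (rule angle_representative)
    then show ?thesis
      using G c2_circle_periodic[OF G(1), of x m] by (metis (no_types, lifting))
  qed
  then obtain G G1 G2 x where G: "\<And>n. c2_circle (G n) (G1 n) (G2 n)"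
    "\<And>n z. \<bar>G1 n z - F1 z\<bar> < e n" "\<And>n z. \<bar>G2 n z - F2 z\<bar> < e n"
    "\<And>n. G1 n (x n) = 0" "\<And>n. G2 n (x n) = 0" "\<And>n. x n \<in> {0..2 * pi}"
    by metis
  obtain a r where r: "strict_mono r" "(x \<circ> r) \<longlonglongrightarrow> a"
    using compact_Icc[of 0 "2 * pi"] G(6) unfolding compact_def by metis
  have er: "(e \<circ> r) \<longlonglongrightarrow> 0" by (rule LIMSEQ_subseq_LIMSEQ[OF e r(1)])
  have "F1 a = 0"
    by (rule zeros_of_nearby_functions[OF c2_circle_continuous(2)[OF F] r(2), where G = "G1 \<circ> r" and e = "e \<circ> r"])
       (auto intro: less_imp_le[OF G(2)] less_imp_le[OF G(3)] G er)
  moreover have "F2 a = 0"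
    by (rule zeros_of_nearby_functions[OF c2_circle_continuous(3)[OF F] r(2), where G = "G2 \<circ> r" and e = "e \<circ> r"])
       (auto intro: less_imp_le[OF G(2)] less_imp_le[OF G(3)] G er)
  ultimately show False using nd by (auto simp: nondegenerate_def)
qed

text \<open>
  Compactness for pairs of critical points.  The only danger is that the two points merge on the circle; after a
  translation by a multiple of the period this is excluded by \<open>coalescing_critical_points\<close>.
\<close>

lemma critical_pairs_stay_apart:
  assumes F: "c2_circle F F1 F2" and nd: "nondegenerate F1 F2"
    and G: "\<And>n. c2_circle (G n) (G1 n) (G2 n)"
    and close: "\<And>n z. \<bar>G1 n z - F1 z\<bar> \<le> e n" "\<And>n z. \<bar>G2 n z - F2 z\<bar> \<le> e n"
    and e: "e \<longlonglongrightarrow> 0"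
    and crit: "\<And>n. G1 n (x n) = 0" "\<And>n. G1 n (y n) = 0"
    and apart: "\<And>n. \<not> same_angle (x n) (y n)"
    and box: "\<And>n. x n \<in> {0..2 * pi}" "\<And>n. y n \<in> {0..2 * pi}"
  obtains a b r where "strict_mono (r :: nat \<Rightarrow> nat)" "(x \<circ> r) \<longlonglongrightarrow> a" "(y \<circ> r) \<longlonglongrightarrow> b"
    "a \<in> {0..2 * pi}" "b \<in> {0..2 * pi}" "F1 a = 0" "F1 b = 0" "\<not> same_angle a b"
proof -
  have "seq_compact ({0..2 * pi} \<times> {0..2 * pi})"
    by (intro compact_imp_seq_compact compact_Times compact_Icc)
  moreover have "\<forall>n. (x n, y n) \<in> {0..2 * pi} \<times> {0..2 * pi}"
    using box by auto
  ultimately obtain l r where r: "strict_mono (r :: nat \<Rightarrow> nat)" and l: "l \<in> {0..2 * pi} \<times> {0..2 * pi}"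
    and lim: "((\<lambda>n. (x n, y n)) \<circ> r) \<longlonglongrightarrow> l"
    by (rule seq_compactE)
  define a b where "a = fst l" and "b = snd l"
  have xa: "(x \<circ> r) \<longlonglongrightarrow> a" and yb: "(y \<circ> r) \<longlonglongrightarrow> b"
    using tendsto_fst[OF lim] tendsto_snd[OF lim] by (simp_all add: a_def b_def o_def)
  have er: "(e \<circ> r) \<longlonglongrightarrow> 0" by (rule LIMSEQ_subseq_LIMSEQ[OF e r])
  have a0: "F1 a = 0"
    by (rule zeros_of_nearby_functions[OF c2_circle_continuous(2)[OF F] xa, where G = "G1 \<circ> r" and e = "e \<circ> r"])
       (auto intro: close crit er)
  have b0: "F1 b = 0"
    by (rule zeros_of_nearby_functions[OF c2_circle_continuous(2)[OF F] yb, where G = "G1 \<circ> r" and e = "e \<circ> r"])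
       (auto intro: close crit er)
  have "\<not> same_angle a b"
  proof
    assume "same_angle a b"
    then obtain m :: int where m: "b = a + 2 * pi * of_int m" by (auto simp: same_angle_def)
    define y' where "y' n = y (r n) + 2 * pi * of_int (- m)" for n
    have "(\<lambda>n. (y \<circ> r) n + 2 * pi * of_int (- m)) \<longlonglongrightarrow> b + 2 * pi * of_int (- m)"
      by (intro tendsto_intros yb)
    then have "y' \<longlonglongrightarrow> a" by (simp add: m y'_def[abs_def])
    moreover have "G1 (r n) (y' n) = 0" for n
      unfolding y'_def by (simp only: c2_circle_periodic(2)[OF G] crit)
    moreover have "x (r n) \<noteq> y' n" for n
      using apart[of "r n"] by (auto simp: same_angle_def y'_def)
    ultimately have "F2 a = 0"
      by (intro coalescing_critical_points[of "G1 \<circ> r" "G2 \<circ> r" F2 "e \<circ> r" a "x \<circ> r" y'])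
         (use c2_circle_derivs(2)[OF G] close er xa crit c2_circle_continuous(3)[OF F] in auto)
    then show False using a0 nd by (auto simp: nondegenerate_def)
  qed
  then show ?thesis using that[OF r xa yb] l a0 b0 by (auto simp: a_def b_def mem_Times_iff)
qed

lemma critical_pair_in_period:
  assumes "c2_circle F F1 F2" "F1 x = 0" "F1 y = 0" "\<not> same_angle x y" "F x = F y"
  obtains x' y' where "F1 x' = 0" "F1 y' = 0" "\<not> same_angle x' y'" "F x' = F y'"
    "x' \<in> {0..2 * pi}" "y' \<in> {0..2 * pi}"
proof -
  obtain k l :: int where kl: "x + 2 * pi * of_int k \<in> {0..2 * pi}"
    "y + 2 * pi * of_int l \<in> {0..2 * pi}"
    by (metis angle_representative)
  have "\<not> same_angle (x + 2 * pi * of_int k) (y + 2 * pi * of_int l)"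
  proof
    assume "same_angle (x + 2 * pi * of_int k) (y + 2 * pi * of_int l)"
    then obtain m :: int where "y + 2 * pi * of_int l = x + 2 * pi * of_int k + 2 * pi * of_int m"
      by (auto simp: same_angle_def)
    then have "y = x + 2 * pi * of_int (k + m - l)" by (simp add: algebra_simps)
    then show False using assms(4) unfolding same_angle_def by blast
  qed
  then show ?thesis
    using that kl assms(2,3,5) c2_circle_periodic[OF assms(1)] by metis
qed

text \<open>
  Nondegeneracy survives by \<open>nondegenerate_stable\<close>.  If equal critical values persisted in
  arbitrarily small perturbations, then the limit of a subsequence of such pairs would be a pair of distinct
  critical points of \<open>F\<close> with equal values.
\<close>

theorem morse_distinct_values_stable:
  assumes F: "c2_circle F F1 F2" and good: "morse_distinct_values F"
  shows "\<exists>e>0. \<forall>G G1 G2. c2_circle G G1 G2 \<longrightarrow>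
           (\<forall>x. \<bar>G x - F x\<bar> < e \<and> \<bar>G1 x - F1 x\<bar> < e \<and> \<bar>G2 x - F2 x\<bar> < e) \<longrightarrow>
           morse_distinct_values G"
proof (rule ccontr)
  assume neg: "\<not> ?thesis"
  have nd: "nondegenerate F1 F2"
    using good morse_distinct_values_iff[OF F] by blast
  obtain d where d: "d > 0" "\<And>G G1 G2. c2_circle G G1 G2 \<Longrightarrow>
      (\<forall>x. \<bar>G1 x - F1 x\<bar> < d \<and> \<bar>G2 x - F2 x\<bar> < d) \<Longrightarrow> nondegenerate G1 G2"
    using nondegenerate_stable[OF F nd] by blast
  \<comment> \<open>Below \<open>d\<close>, the counterexamples are nondegenerate, so they can only fail by equal critical values.\<close>
  define e where "e n = min d (inverse (real (Suc n)))" for n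
  have e_inv: "e n \<le> inverse (real (Suc n))" and e_d: "e n \<le> d" and e_pos: "e n > 0" for n
    using d(1) by (auto simp: e_def)
  have e: "e \<longlonglongrightarrow> 0"
    by (rule Lim_null_comparison[OF _ LIMSEQ_inverse_real_of_nat])
       (use e_inv e_pos in \<open>auto simp: less_imp_le\<close>)
  have "\<exists>G G1 G2 x y. c2_circle G G1 G2 \<and>
          (\<forall>x. \<bar>G x - F x\<bar> < e n \<and> \<bar>G1 x - F1 x\<bar> < e n \<and> \<bar>G2 x - F2 x\<bar> < e n)
          \<and> G1 x = 0 \<and> G1 y = 0 \<and> G x = G y \<and> \<not> same_angle x y
          \<and> x \<in> {0..2 * pi} \<and> y \<in> {0..2 * pi}" for n
  proof -
    obtain G G1 G2 where G: "c2_circle G G1 G2"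
      "\<forall>x. \<bar>G x - F x\<bar> < e n \<and> \<bar>G1 x - F1 x\<bar> < e n \<and> \<bar>G2 x - F2 x\<bar> < e n"
      "\<not> morse_distinct_values G"
      using neg e_pos[of n] by blast
    have "nondegenerate G1 G2"
      by (rule d(2)[OF G(1)]) (use G(2) e_d[of n] in \<open>auto intro: less_le_trans\<close>)
    then obtain x y where "G1 x = 0" "G1 y = 0" "\<not> same_angle x y" "G x = G y"
      using G(3) morse_distinct_values_iff[OF G(1)] by auto
    then show ?thesis
      using critical_pair_in_period[OF G(1)] G by (metis (no_types, lifting))
  qed
  then obtain G G1 G2 x y where G: "\<And>n. c2_circle (G n) (G1 n) (G2 n)"
    "\<And>n z. \<bar>G n z - F z\<bar> < e n" "\<And>n z. \<bar>G1 n z - F1 z\<bar> < e n" "\<And>n z. \<bar>G2 n z - F2 z\<bar> < e n"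
    "\<And>n. G1 n (x n) = 0" "\<And>n. G1 n (y n) = 0" "\<And>n. G n (x n) = G n (y n)"
    "\<And>n. \<not> same_angle (x n) (y n)"
    "\<And>n. x n \<in> {0..2 * pi}" "\<And>n. y n \<in> {0..2 * pi}"
    by metis
  obtain a b r where r: "strict_mono (r :: nat \<Rightarrow> nat)"
    and lim: "(x \<circ> r) \<longlonglongrightarrow> a" "(y \<circ> r) \<longlonglongrightarrow> b"
    and ab: "F1 a = 0" "F1 b = 0" "\<not> same_angle a b"
    by (rule critical_pairs_stay_apart[OF F nd G(1) less_imp_le[OF G(3)] less_imp_le[OF G(4)] e
          G(5,6,8,9,10)])
  have er: "(e \<circ> r) \<longlonglongrightarrow> 0" by (rule LIMSEQ_subseq_LIMSEQ[OF e r])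
  have "(\<lambda>n. F (x (r n)) - F (y (r n))) \<longlonglongrightarrow> F a - F b"
    using lim by (intro tendsto_diff isCont_tendsto_compose[OF c2_circle_continuous(1)[OF F]])
      (auto simp: o_def)
  moreover have "(\<lambda>n. F (x (r n)) - F (y (r n))) \<longlonglongrightarrow> 0"
  proof (rule Lim_null_comparison)
    show "\<forall>\<^sub>F n in sequentially. norm (F (x (r n)) - F (y (r n))) \<le> 2 * (e \<circ> r) n"
    proof (intro always_eventually allI)
      fix n
      show "norm (F (x (r n)) - F (y (r n))) \<le> 2 * (e \<circ> r) n"
        using G(2)[of "r n" "x (r n)"] G(2)[of "r n" "y (r n)"] G(7)[of "r n"] by simp
    qed
    show "(\<lambda>n. 2 * (e \<circ> r) n) \<longlonglongrightarrow> 0" using tendsto_mult_right_zero[OF er] .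
  qed
  ultimately have "F a = F b" using LIMSEQ_unique by fastforce
  then show False using ab good morse_distinct_values_iff[OF F] by blast
qed

lemma morse_distinct_values_cos:
  "c2_circle cos (\<lambda>x. - sin x) (\<lambda>x. - cos x)" "morse_distinct_values cos"
proof -
  show c2: "c2_circle cos (\<lambda>x. - sin x) (\<lambda>x. - cos x)"
    unfolding c2_circle_def
  proof (intro conjI allI)
    fix x :: real and m :: int
    have "sin (x + 2 * pi * of_int m) = sin x \<and> cos (x + 2 * pi * of_int m) = cos x"
      unfolding sin_cos_eq_iff by (intro exI[of _ m]) simp
    then show "cos (x + 2 * pi * of_int m) = cos x" "- sin (x + 2 * pi * of_int m) = - sin x"
      "- cos (x + 2 * pi * of_int m) = - cos x" by auto
  qed (auto intro!: derivative_eq_intros continuous_intros)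
  show "morse_distinct_values cos"
    unfolding morse_distinct_values_iff[OF c2] nondegenerate_def same_angle_def
  proof (intro conjI allI impI)
    fix x :: real assume "- sin x = 0"
    then show "- cos x \<noteq> 0" using sin_zero_abs_cos_one by fastforce
  next
    fix x y :: real
    assume "- sin x = 0 \<and> - sin y = 0 \<and> (\<nexists>m::int. y = x + 2 * pi * of_int m)"
    then have "sin y = sin x" "\<not> (sin y = sin x \<and> cos y = cos x)"
      unfolding sin_cos_eq_iff by simp_all
    then show "cos x \<noteq> cos y" by simp
  qed
qed

lemma c2_circle_add_wave:
  assumes "c2_circle F F1 F2"
  shows "c2_circle (\<lambda>x. F x + Re (w * cis x)) (\<lambda>x. F1 x - Im (w * cis x)) (\<lambda>x. F2 x - Re (w * cis x))"
proof -
  have per: "cis (x + 2 * pi * of_int m) = cis x" for x and m :: int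
    by (simp add: cis_mult[symmetric])
  show ?thesis
    unfolding c2_circle_def per c2_circle_periodic[OF assms]
  proof (intro conjI allI)
    fix x
    show "((\<lambda>x. F x + Re (w * cis x)) has_real_derivative F1 x - Im (w * cis x)) (at x)"
      using c2_circle_derivs[OF assms, of x]
      by (auto intro!: derivative_eq_intros simp: algebra_simps)
    show "((\<lambda>x. F1 x - Im (w * cis x)) has_real_derivative F2 x - Re (w * cis x)) (at x)"
      using c2_circle_derivs[OF assms, of x]
      by (auto intro!: derivative_eq_intros simp: algebra_simps)
    show "continuous_on UNIV (\<lambda>x. F2 x - Re (w * cis x))"
      using assms by (auto simp: c2_circle_def intro!: continuous_intros)
  qed auto
qed

text \<open>
  At a degenerate critical point \<open>x\<close> of the perturbed function, both real equations together say
  \<open>w * cis x = F2 x + \<i> * F1 x\<close>.  So \<open>x\<close> determines \<open>w\<close>, and the bad \<open>w\<close> form a differentiable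
  curve, which has measure zero in the plane.
\<close>

lemma nondegenerate_by_wave:
  assumes F1: "\<And>x. (F1 has_real_derivative F2 x) (at x)"
    and F2: "\<And>x. (F2 has_real_derivative F3 x) (at x)" and e: "e > 0"
  shows "\<exists>w. cmod w < e \<and> nondegenerate (\<lambda>x. F1 x - Im (w * cis x)) (\<lambda>x. F2 x - Re (w * cis x))"
proof -
  define \<gamma> where "\<gamma> x = Complex (F2 x) (F1 x) * cis (- x)" for x
  have "\<gamma> differentiable_on UNIV"
  proof -
    have "\<gamma> = (\<lambda>x. (of_real (F2 x) + \<i> * of_real (F1 x)) * (of_real (cos x) - \<i> * of_real (sin x)))"
      by (simp add: \<gamma>_def fun_eq_iff complex_eq_iff)
    moreover have "\<dots> differentiable_on UNIV"
    proof -
      have real: "(\<lambda>x. complex_of_real (g x)) differentiable at x"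
        if "(g has_real_derivative d) (at x)" for g d x
        using that by (auto simp: differentiable_def has_field_derivative_def intro: has_derivative_of_real)
      show ?thesis
        unfolding differentiable_on_def
        by (intro ballI differentiable_mult differentiable_add differentiable_diff differentiable_const
            real[OF F1] real[OF F2] real[OF DERIV_sin] real[OF DERIV_cos])
    qed
    ultimately show ?thesis by simp
  qed
  then have "negligible (range \<gamma>)"
    by (intro negligible_differentiable_image_lowdim) auto
  then have "\<not> ball 0 e \<subseteq> range \<gamma>"
    using open_not_negligible[of "ball (0::complex) e"] e negligible_subset by auto
  then obtain w where "w \<in> ball 0 e" and w_notin: "w \<notin> range \<gamma>" by blast
  then have w_small: "cmod w < e" by simp
  have "nondegenerate (\<lambda>x. F1 x - Im (w * cis x)) (\<lambda>x. F2 x - Re (w * cis x))"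
    unfolding nondegenerate_def
  proof (intro allI impI notI)
    fix x assume "F1 x - Im (w * cis x) = 0" "F2 x - Re (w * cis x) = 0"
    then have "w * cis x = Complex (F2 x) (F1 x)" by (simp add: complex_eq_iff)
    then have "w * cis x * cis (- x) = \<gamma> x" by (simp add: \<gamma>_def)
    then have "w = \<gamma> x" by (simp add: mult.assoc cis_mult)
    then show False using w_notin by blast
  qed
  then show ?thesis using w_small by blast
qed

lemma finite_critical_points:
  assumes F: "c2_circle F F1 F2" and nd: "nondegenerate F1 F2"
  shows "finite {x \<in> {0..2 * pi}. F1 x = 0}"
proof -
  have "\<not> a islimpt {x. F1 x = 0}" for a
  proof
  fix a assume "a islimpt {x. F1 x = 0}"
  moreover have "closed {x. F1 x = 0}"
    using c2_circle_continuous(2)[OF F]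
    by (intro closed_Collect_eq) (auto simp: continuous_on_eq_continuous_at)
  ultimately have a: "F1 a = 0" by (auto dest: closed_limpt[THEN iffD1])
  then have "F2 a \<noteq> 0" using nd by (auto simp: nondegenerate_def)
  moreover have "((\<lambda>y. (F1 y - F1 a) / (y - a)) \<longlongrightarrow> F2 a) (at a)"
    using c2_circle_derivs(2)[OF F, of a] by (simp add: has_field_derivative_iff)
  ultimately have "\<forall>\<^sub>F y in at a. (F1 y - F1 a) / (y - a) \<noteq> 0"
    using tendsto_imp_eventually_ne by blast
  then have "\<forall>\<^sub>F y in at a. F1 y \<noteq> 0"
    by eventually_elim (auto simp: a)
  then show False
    using \<open>a islimpt _\<close> by (auto simp: islimpt_iff_eventually)
  qed
  then have "finite ({0..2 * pi} \<inter> {x. F1 x = 0})"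
    by (intro finite_not_islimpt_in_compact compact_Icc)
  then show ?thesis by (simp add: Int_def)
qed

text \<open>
  Each pair of different angles excludes only the phases of its two perpendicular bisectors.
\<close>

lemma exists_separating_phase:
  assumes "finite (K :: real set)"
  shows "\<exists>p. \<forall>a\<in>K. \<forall>b\<in>K. cos (a - p) = cos (b - p) \<longrightarrow> same_angle a b"
proof -
  define B where "B = (\<Union>a\<in>K. \<Union>b\<in>K. range (\<lambda>m::int. (a + b) / 2 + pi * of_int m))"
  have "countable B"
    unfolding B_def
    by (intro countable_UN countable_image countableI_type countable_finite[OF assms])
  then obtain p where p: "p \<notin> B"
    using uncountable_UNIV_real by (metis UNIV_I countable_subset subsetI)
  have "same_angle a b" if ab: "a \<in> K" "b \<in> K" "cos (a - p) = cos (b - p)" for a b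
  proof -
    obtain k where "k \<in> \<int>" "b - p = (a - p) + 2 * k * pi \<or> b - p = - (a - p) + 2 * k * pi"
      using ab(3)[symmetric] unfolding cos_eq by blast
    then obtain m :: int where "b - p = (a - p) + 2 * m * pi \<or> b - p = - (a - p) + 2 * m * pi"
      by (auto elim!: Ints_cases)
    then show ?thesis
    proof
      assume "b - p = - (a - p) + 2 * m * pi"
      then have "p = (a + b) / 2 + pi * of_int (- m)" by (simp add: field_simps)
      then have "p \<in> B" unfolding B_def using ab by blast
      then show ?thesis using p by simp
    qed (auto simp: same_angle_def algebra_simps)
  qed
  then show ?thesis by blast
qed

text \<open>
  The envelope principle: under a perturbation of size \<open>t\<close>, a nondegenerate critical point moves by \<open>O(t)\<close>,
  and since the derivative vanishes there, the value of the unperturbed function moves only by \<open>o(t)\<close>.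
\<close>

lemma critical_value_first_order:
  assumes F: "c2_circle F F1 F2" and a: "F1 a = 0" "F2 a \<noteq> 0"
    and x: "x \<longlonglongrightarrow> a" and t: "t \<longlonglongrightarrow> 0" "\<And>n. t n \<noteq> (0::real)"
    and q: "isCont q a" and crit: "\<And>n. F1 (x n) = t n * q (x n)"
  shows "(\<lambda>n. (F (x n) - F a) / t n) \<longlonglongrightarrow> 0"
proof -
  have "\<forall>n. \<exists>z. \<bar>z - a\<bar> \<le> \<bar>x n - a\<bar> \<and> F (x n) - F a = (x n - a) * F1 z"
    by (intro allI mean_value_near c2_circle_derivs(1)[OF F])
  then obtain \<xi> where \<xi>: "\<And>n. \<bar>\<xi> n - a\<bar> \<le> \<bar>x n - a\<bar>" "\<And>n. F (x n) - F a = (x n - a) * F1 (\<xi> n)"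
    by metis
  have "\<forall>n. \<exists>z. \<bar>z - a\<bar> \<le> \<bar>x n - a\<bar> \<and> F1 (x n) - F1 a = (x n - a) * F2 z"
    by (intro allI mean_value_near c2_circle_derivs(2)[OF F])
  then obtain \<eta> where \<eta>: "\<And>n. \<bar>\<eta> n - a\<bar> \<le> \<bar>x n - a\<bar>" "\<And>n. F1 (x n) - F1 a = (x n - a) * F2 (\<eta> n)"
    by metis
  have 1: "(\<lambda>n. F1 (\<xi> n)) \<longlonglongrightarrow> F1 a"
    by (rule isCont_tendsto_compose[OF c2_circle_continuous(2)[OF F] tendsto_near[OF x \<xi>(1)]])
  have 2: "(\<lambda>n. F2 (\<eta> n)) \<longlonglongrightarrow> F2 a"
    by (rule isCont_tendsto_compose[OF c2_circle_continuous(3)[OF F] tendsto_near[OF x \<eta>(1)]])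
  have 3: "(\<lambda>n. q (x n)) \<longlonglongrightarrow> q a"
    by (rule isCont_tendsto_compose[OF q x])
  have "(\<lambda>n. q (x n) / F2 (\<eta> n) * F1 (\<xi> n)) \<longlonglongrightarrow> q a / F2 a * F1 a"
    by (intro tendsto_intros 1 2 3 a(2))
  then have lim: "(\<lambda>n. q (x n) / F2 (\<eta> n) * F1 (\<xi> n)) \<longlonglongrightarrow> 0"
    by (simp add: a)
  have "\<forall>\<^sub>F n in sequentially. F2 (\<eta> n) \<noteq> 0"
    by (rule tendsto_imp_eventually_ne[OF 2 a(2)])
  then have "\<forall>\<^sub>F n in sequentially. q (x n) / F2 (\<eta> n) * F1 (\<xi> n) = (F (x n) - F a) / t n"
  proof eventually_elim
    case (elim n)
    have "x n - a = t n * q (x n) / F2 (\<eta> n)"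
      using \<eta>(2)[of n] elim by (simp add: a crit field_simps)
    then show ?case
      using t(2)[of n] by (simp add: \<xi>(2))
  qed
  then show ?thesis using lim by (rule Lim_transform_eventually[rotated])
qed

text \<open>
  Suppose that all small multiples of \<open>cos (x - p)\<close> leave two critical points with equal values.  In the
  limit these become critical points \<open>a\<close> and \<open>b\<close> of \<open>F\<close>, and dividing the equality of the values by
  \<open>t\<close> gives \<open>cos (a - p) = cos (b - p)\<close> by \<open>critical_value_first_order\<close>, contrary to the choice of \<open>p\<close>.
\<close>

lemma distinct_values_by_wave:
  assumes F: "c2_circle F F1 F2" and nd: "nondegenerate F1 F2" and e: "e > 0"
  shows "\<exists>w. cmod w < e \<and> morse_distinct_values (\<lambda>x. F x + Re (w * cis x))"
proof (rule ccontr)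
  assume neg: "\<not> ?thesis"
  obtain d where d: "d > 0" "\<And>G G1 G2. c2_circle G G1 G2 \<Longrightarrow>
      (\<forall>x. \<bar>G1 x - F1 x\<bar> < d \<and> \<bar>G2 x - F2 x\<bar> < d) \<Longrightarrow> nondegenerate G1 G2"
    using nondegenerate_stable[OF F nd] by blast
  obtain p where p: "\<And>a b. a \<in> {0..2 * pi} \<Longrightarrow> b \<in> {0..2 * pi} \<Longrightarrow> F1 a = 0 \<Longrightarrow> F1 b = 0 \<Longrightarrow>
      cos (a - p) = cos (b - p) \<Longrightarrow> same_angle a b"
    using exists_separating_phase[OF finite_critical_points[OF F nd]] by blast
  define t where "t n = min d e / 2 * inverse (real (Suc n))" for n
  have t_pos: "t n > 0" for n using d(1) e by (simp add: t_def)
  have t_le: "t n < d" "t n < e" for n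
  proof -
    have "t n \<le> min d e / 2 * 1"
      unfolding t_def using d(1) e by (intro mult_left_mono) (auto simp: field_simps)
    then show "t n < d" "t n < e" using d(1) e by auto
  qed
  have t: "t \<longlonglongrightarrow> 0"
    unfolding t_def by (intro tendsto_mult_right_zero LIMSEQ_inverse_real_of_nat)
  define w where "w n = of_real (t n) * cis (- p)" for n
  have norm_w: "cmod (w n) = t n" for n
    using t_pos[of n] by (simp add: w_def norm_mult)
  have w_cis: "w n * cis x = of_real (t n) * cis (x - p)" for n x
    by (simp add: w_def mult.assoc cis_mult)
  have Re_w: "Re (w n * cis x) = t n * cos (x - p)" and Im_w: "Im (w n * cis x) = t n * sin (x - p)"
    for n x by (simp_all add: w_cis)
  define G where "G n x = F x + t n * cos (x - p)" for n x
  define G1 where "G1 n x = F1 x - t n * sin (x - p)" for n x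
  define G2 where "G2 n x = F2 x - t n * cos (x - p)" for n x
  have G: "c2_circle (G n) (G1 n) (G2 n)" for n
    using c2_circle_add_wave[OF F, of "w n"]
    by (simp only: G_def[abs_def] G1_def[abs_def] G2_def[abs_def] Re_w Im_w)
  have close: "\<bar>G1 n z - F1 z\<bar> \<le> t n" "\<bar>G2 n z - F2 z\<bar> \<le> t n" for n z
    using t_pos[of n] by (auto simp: G1_def G2_def abs_mult intro!: mult_left_le)
  have "\<exists>x y. G1 n x = 0 \<and> G1 n y = 0 \<and> \<not> same_angle x y \<and> G n x = G n y
          \<and> x \<in> {0..2 * pi} \<and> y \<in> {0..2 * pi}" for n
  proof -
    have "nondegenerate (G1 n) (G2 n)"
      using d(2)[OF G, of n] close t_le(1)[of n] le_less_trans by blast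
    moreover have "\<not> morse_distinct_values (G n)"
    proof
      assume "morse_distinct_values (G n)"
      then have "morse_distinct_values (\<lambda>x. F x + Re (w n * cis x))"
        by (simp only: G_def[abs_def] Re_w)
      then show False using neg norm_w[of n] t_le(2)[of n] by auto
    qed
    ultimately obtain x y where "G1 n x = 0" "G1 n y = 0" "\<not> same_angle x y" "G n x = G n y"
      using morse_distinct_values_iff[OF G, of n] by auto
    then show ?thesis using critical_pair_in_period[OF G, of n] by metis
  qed
  then obtain x y where xy: "\<And>n. G1 n (x n) = 0" "\<And>n. G1 n (y n) = 0"
    "\<And>n. \<not> same_angle (x n) (y n)" "\<And>n. G n (x n) = G n (y n)"
    "\<And>n. x n \<in> {0..2 * pi}" "\<And>n. y n \<in> {0..2 * pi}" by metis
  obtain a b r where r: "strict_mono (r :: nat \<Rightarrow> nat)"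
    and lim: "(x \<circ> r) \<longlonglongrightarrow> a" "(y \<circ> r) \<longlonglongrightarrow> b"
    and box: "a \<in> {0..2 * pi}" "b \<in> {0..2 * pi}"
    and ab: "F1 a = 0" "F1 b = 0" "\<not> same_angle a b"
    by (rule critical_pairs_stay_apart[OF F nd G close t xy(1,2,3,5,6)])
  have tr: "(t \<circ> r) \<longlonglongrightarrow> 0" by (rule LIMSEQ_subseq_LIMSEQ[OF t r])
  have nz: "F2 a \<noteq> 0" "F2 b \<noteq> 0" using nd ab by (auto simp: nondegenerate_def)
  have q: "isCont (\<lambda>x. sin (x - p)) c" for c :: real
    by (intro continuous_intros)
  have crit: "F1 (x n) = t n * sin (x n - p)" "F1 (y n) = t n * sin (y n - p)" for n
    using xy(1,2)[of n] by (simp_all add: G1_def)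
  have t_nz: "(t \<circ> r) n \<noteq> 0" for n using t_pos[of "r n"] by simp
  have first_order: "(\<lambda>n. (F ((x \<circ> r) n) - F a) / (t \<circ> r) n) \<longlonglongrightarrow> 0"
    by (rule critical_value_first_order[OF F ab(1) nz(1) lim(1) tr t_nz q]) (simp add: crit)
  have first_order': "(\<lambda>n. (F ((y \<circ> r) n) - F b) / (t \<circ> r) n) \<longlonglongrightarrow> 0"
    by (rule critical_value_first_order[OF F ab(2) nz(2) lim(2) tr t_nz q]) (simp add: crit)
  have cos_lim: "(\<lambda>n. cos ((x \<circ> r) n - p)) \<longlonglongrightarrow> cos (a - p)" "(\<lambda>n. cos ((y \<circ> r) n - p)) \<longlonglongrightarrow> cos (b - p)"
    by (intro tendsto_intros lim)+
  have eq: "F ((x \<circ> r) n) + (t \<circ> r) n * cos ((x \<circ> r) n - p) = F ((y \<circ> r) n) + (t \<circ> r) n * cos ((y \<circ> r) n - p)" for n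
    using xy(4)[of "r n"] by (simp add: G_def)
  have "F a = F b"
  proof (rule LIMSEQ_unique)
    show "(\<lambda>n. F ((x \<circ> r) n) + (t \<circ> r) n * cos ((x \<circ> r) n - p)) \<longlonglongrightarrow> F a"
      using tendsto_add[OF isCont_tendsto_compose[OF c2_circle_continuous(1)[OF F] lim(1)]
          tendsto_mult[OF tr cos_lim(1)]] by simp
    show "(\<lambda>n. F ((x \<circ> r) n) + (t \<circ> r) n * cos ((x \<circ> r) n - p)) \<longlonglongrightarrow> F b"
      using tendsto_add[OF isCont_tendsto_compose[OF c2_circle_continuous(1)[OF F] lim(2)]
          tendsto_mult[OF tr cos_lim(2)]] by (simp only: eq) simp
  qed
  have "cos ((x \<circ> r) n - p) - cos ((y \<circ> r) n - p) =
      (F ((y \<circ> r) n) - F b) / (t \<circ> r) n - (F ((x \<circ> r) n) - F a) / (t \<circ> r) n" for n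
    using eq[of n] t_pos[of "r n"] \<open>F a = F b\<close> by (simp add: field_simps)
  then have "(\<lambda>n. cos ((x \<circ> r) n - p) - cos ((y \<circ> r) n - p)) \<longlonglongrightarrow> 0 - 0"
    using tendsto_diff[OF first_order' first_order] by simp
  then have "cos (a - p) - cos (b - p) = 0 - 0"
    by (rule LIMSEQ_unique[OF tendsto_diff[OF cos_lim]])
  then show False using p[OF box ab(1,2)] ab(3) by simp
qed

theorem morse_distinct_values_by_wave:
  assumes F: "c2_circle F F1 F2" and F3: "\<And>x. (F2 has_real_derivative F3 x) (at x)" and e: "e > 0"
  shows "\<exists>w. cmod w < e \<and> morse_distinct_values (\<lambda>x. F x + Re (w * cis x))"
proof -
  obtain u where u: "cmod u < e / 2"
    "nondegenerate (\<lambda>x. F1 x - Im (u * cis x)) (\<lambda>x. F2 x - Re (u * cis x))"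
    using nondegenerate_by_wave[OF c2_circle_derivs(2)[OF F] F3, of "e / 2"] e by auto
  obtain v where v: "cmod v < e / 2"
    "morse_distinct_values (\<lambda>x. F x + Re (u * cis x) + Re (v * cis x))"
    using distinct_values_by_wave[OF c2_circle_add_wave[OF F] u(2), of "e / 2"] e by auto
  have "cmod (u + v) < e"
    using norm_triangle_ineq[of u v] u(1) v(1) by simp
  moreover have "(\<lambda>x. F x + Re (u * cis x) + Re (v * cis x)) = (\<lambda>x. F x + Re ((u + v) * cis x))"
    by (simp add: fun_eq_iff algebra_simps)
  ultimately show ?thesis using v(2) by auto
qed


section \<open>Trigonometric series with exponentially decaying coefficients\<close>

text \<open>
  The \<open>m\<close>-th derivative, taken term by term, of the real part of \<open>\<Sum>j. c j * cis (j * x)\<close>.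
\<close>

definition wave_series :: "nat \<Rightarrow> (nat \<Rightarrow> complex) \<Rightarrow> real \<Rightarrow> real" where
  "wave_series m c x = (\<Sum>j. Re ((\<i> * of_nat j) ^ m * c j * cis (real j * x)))"

definition decays :: "real \<Rightarrow> real \<Rightarrow> (nat \<Rightarrow> complex) \<Rightarrow> bool" where
  "decays \<sigma> M c \<longleftrightarrow> (\<forall>j. cmod (c j) \<le> M * exp (- \<sigma> * real j))"

definition decay_moment :: "nat \<Rightarrow> real \<Rightarrow> real" where
  "decay_moment m \<sigma> = (\<Sum>j. real j ^ m * exp (- \<sigma> * real j))"

lemma summable_decay_moment:
  assumes "\<sigma> > 0"
  shows "summable (\<lambda>j. real j ^ m * exp (- \<sigma> * real j))"
proof -
  have "norm (exp (- \<sigma> / 2)) < 1" using assms by simp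
  then have geo: "summable (\<lambda>j. exp (- \<sigma> / 2) ^ j)" by (rule summable_geometric)
  have "(\<lambda>j. real j ^ m * exp (- \<sigma> * real j)) \<in> O(\<lambda>j. exp (- \<sigma> / 2) ^ j)"
  proof (rule bigoI_tendsto)
    have eq: "real j ^ m * exp (- \<sigma> * real j) / exp (- \<sigma> / 2) ^ j
        = (2 / \<sigma>) ^ m * ((\<sigma> / 2 * real j) ^ m / exp (\<sigma> / 2 * real j))" for j
    proof -
      have "exp (- \<sigma> / 2) ^ j = exp (- \<sigma> / 2 * real j)"
        by (simp add: exp_of_nat_mult[symmetric] mult.commute)
      moreover have "exp (- \<sigma> * real j) = exp (- \<sigma> / 2 * real j) * exp (- (\<sigma> / 2 * real j))"
        by (simp add: exp_add[symmetric])
      ultimately show ?thesis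
        using assms by (simp add: exp_minus power_mult_distrib field_simps power_divide)
    qed
    have "filterlim (\<lambda>j. \<sigma> / 2 * real j) at_top sequentially"
      using assms by (intro filterlim_tendsto_pos_mult_at_top[OF tendsto_const] filterlim_real_sequentially) auto
    then have "(\<lambda>j. (\<sigma> / 2 * real j) ^ m / exp (\<sigma> / 2 * real j)) \<longlonglongrightarrow> 0"
      by (rule filterlim_compose[OF tendsto_power_div_exp_0])
    then show "(\<lambda>j. real j ^ m * exp (- \<sigma> * real j) / exp (- \<sigma> / 2) ^ j) \<longlonglongrightarrow> 0"
      unfolding eq by (rule tendsto_mult_right_zero)
  qed (auto intro: always_eventually)
  then show ?thesis
    by (rule summable_comparison_test_bigo[rotated]) (use geo in simp)
qed

lemma decay_moment_nonneg: "\<sigma> > 0 \<Longrightarrow> decay_moment m \<sigma> \<ge> 0"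
  unfolding decay_moment_def by (intro suminf_nonneg summable_decay_moment) auto

lemma wave_term_bound:
  assumes "decays \<sigma> M c"
  shows "\<bar>Re ((\<i> * of_nat j) ^ m * c j * cis (real j * x))\<bar> \<le> M * (real j ^ m * exp (- \<sigma> * real j))"
proof -
  have "\<bar>Re ((\<i> * of_nat j) ^ m * c j * cis (real j * x))\<bar> \<le> real j ^ m * cmod (c j)"
    by (rule order_trans[OF abs_Re_le_cmod]) (simp add: norm_mult norm_power)
  also have "\<dots> \<le> real j ^ m * (M * exp (- \<sigma> * real j))"
    using assms unfolding decays_def by (intro mult_left_mono) auto
  finally show ?thesis by (simp add: mult_ac)
qed

lemma wave_summable:
  assumes "\<sigma> > 0" "decays \<sigma> M c"
  shows "summable (\<lambda>j. Re ((\<i> * of_nat j) ^ m * c j * cis (real j * x)))"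
  by (rule summable_comparison_test'[OF summable_mult[OF summable_decay_moment[OF assms(1), of m], of M], of 0])
     (use wave_term_bound[OF assms(2)] in simp)

lemma wave_series_bound:
  assumes "\<sigma> > 0" "decays \<sigma> M c"
  shows "\<bar>wave_series m c x\<bar> \<le> M * decay_moment m \<sigma>"
proof -
  define f where "f j = Re ((\<i> * of_nat j) ^ m * c j * cis (real j * x))" for j
  define g where "g j = M * (real j ^ m * exp (- \<sigma> * real j))" for j
  have fg: "\<bar>f j\<bar> \<le> g j" for j
    unfolding f_def g_def by (rule wave_term_bound[OF assms(2)])
  have g: "summable g"
    unfolding g_def by (intro summable_mult summable_decay_moment assms(1))
  have f: "summable (\<lambda>j. \<bar>f j\<bar>)"
    by (rule summable_comparison_test'[OF g, of 0]) (simp add: fg)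
  have "\<bar>suminf f\<bar> \<le> (\<Sum>j. \<bar>f j\<bar>)" by (rule summable_rabs[OF f])
  also have "\<dots> \<le> suminf g" by (rule suminf_le[OF fg f g])
  also have "suminf g = M * decay_moment m \<sigma>"
    unfolding g_def decay_moment_def by (rule suminf_mult[OF summable_decay_moment[OF assms(1)]])
  finally show ?thesis by (simp add: wave_series_def f_def[abs_def])
qed

lemma wave_series_has_derivative:
  assumes "\<sigma> > 0" "decays \<sigma> M c"
  shows "(wave_series m c has_real_derivative wave_series (Suc m) c x) (at x)"
  unfolding wave_series_def[abs_def]
proof (rule has_field_derivative_series'(2)[where S = UNIV and ?x0.0 = 0])
  fix j :: nat and x :: real
  define a where "a = (\<i> * of_nat j) ^ m * c j"
  have "((\<lambda>x. Re (a * cis (real j * x))) has_real_derivative Re (\<i> * of_nat j * a * cis (real j * x))) (at x)"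
    by (auto intro!: derivative_eq_intros simp: algebra_simps)
  then show "((\<lambda>x. Re ((\<i> * of_nat j) ^ m * c j * cis (real j * x))) has_real_derivative
      Re ((\<i> * of_nat j) ^ Suc m * c j * cis (real j * x))) (at x)"
    by (simp only: a_def power_Suc mult.assoc)
next
  show "uniformly_convergent_on UNIV
      (\<lambda>n x. \<Sum>j<n. Re ((\<i> * of_nat j) ^ Suc m * c j * cis (real j * x)))"
    by (rule Weierstrass_m_test'[OF _ summable_mult[OF summable_decay_moment[OF assms(1), of "Suc m"], of M]])
       (use wave_term_bound[OF assms(2)] in \<open>simp only: real_norm_def\<close>)
qed (simp_all only: wave_summable[OF assms] convex_UNIV UNIV_I interior_UNIV)

lemma wave_series_periodic: "wave_series m c (x + 2 * pi * of_int k) = wave_series m c x"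
proof -
  have "cis (real j * (x + 2 * pi * of_int k)) = cis (real j * x)" for j
  proof -
    have "real j * (x + 2 * pi * of_int k) = real j * x + 2 * pi * of_int (int j * k)"
      by (simp add: algebra_simps)
    then show ?thesis by (simp add: cis_mult[symmetric] del: of_int_mult)
  qed
  then show ?thesis by (simp add: wave_series_def)
qed

lemma c2_circle_wave_series:
  assumes "\<sigma> > 0" "decays \<sigma> M c"
  shows "c2_circle (wave_series 0 c) (wave_series 1 c) (wave_series 2 c)"
proof -
  have "continuous_on UNIV (wave_series 2 c)"
    by (intro continuous_at_imp_continuous_on ballI DERIV_isCont[OF wave_series_has_derivative[OF assms]])
  then show ?thesis
    using wave_series_has_derivative[OF assms, of 0] wave_series_has_derivative[OF assms, of 1]
    by (simp add: c2_circle_def wave_series_periodic numeral_2_eq_2)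
qed

lemma wave_series_diff:
  assumes "\<sigma> > 0" "decays \<sigma> M c" "decays \<sigma> L d"
  shows "wave_series m (\<lambda>j. c j - d j) x = wave_series m c x - wave_series m d x"
  unfolding wave_series_def
  by (subst suminf_diff[OF wave_summable[OF assms(1,2)] wave_summable[OF assms(1,3)]])
     (simp add: ring_distribs)

lemma wave_series_single:
  "wave_series m (\<lambda>j. if j = 1 then w else 0) x = Re (\<i> ^ m * w * cis x)"
  unfolding wave_series_def by (subst suminf_finite[of "{1}"]) auto

lemma decays_single: "decays \<sigma> (cmod w * exp \<sigma>) (\<lambda>j. if j = 1 then w else 0)"
  by (auto simp: decays_def exp_minus field_simps)

text \<open>
  The \<open>C\<^sup>2\<close> distance of two series is controlled by the weighted supremum distance of their coefficients,
  through the moments of order at most two.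
\<close>

lemma morse_wave_series_stable:
  assumes s: "\<sigma> > 0" and c: "decays \<sigma> M c" and morse: "morse_distinct_values (wave_series 0 c)"
  shows "\<exists>r>0. \<forall>d. decays \<sigma> r (\<lambda>j. d j - c j) \<longrightarrow> morse_distinct_values (wave_series 0 d)"
proof -
  obtain e where e: "e > 0" "\<And>G G1 G2. c2_circle G G1 G2 \<Longrightarrow>
      (\<forall>x. \<bar>G x - wave_series 0 c x\<bar> < e \<and> \<bar>G1 x - wave_series 1 c x\<bar> < e \<and> \<bar>G2 x - wave_series 2 c x\<bar> < e)
      \<Longrightarrow> morse_distinct_values G"
    using morse_distinct_values_stable[OF c2_circle_wave_series[OF s c] morse] by blast
  define S where "S = decay_moment 0 \<sigma> + decay_moment 1 \<sigma> + decay_moment 2 \<sigma>"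
  have S: "decay_moment 0 \<sigma> \<le> S" "decay_moment 1 \<sigma> \<le> S" "decay_moment 2 \<sigma> \<le> S" "S \<ge> 0"
    using decay_moment_nonneg[OF s] by (simp_all add: S_def)
  define r where "r = e / (S + 1)"
  have r: "r > 0" "r * S < e"
    using e(1) S(4) by (auto simp: r_def field_simps)
  have "morse_distinct_values (wave_series 0 d)" if d: "decays \<sigma> r (\<lambda>j. d j - c j)" for d
  proof (rule e(2)[OF c2_circle_wave_series[OF s]])
    show dd: "decays \<sigma> (M + r) d"
      unfolding decays_def
    proof
      fix j
      have "cmod (d j) \<le> cmod (d j - c j) + cmod (c j)"
        using norm_triangle_ineq[of "d j - c j" "c j"] by simp
      also have "\<dots> \<le> r * exp (- \<sigma> * real j) + M * exp (- \<sigma> * real j)"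
        using c d unfolding decays_def by (intro add_mono) auto
      finally show "cmod (d j) \<le> (M + r) * exp (- \<sigma> * real j)" by (simp add: algebra_simps)
    qed
    have "\<bar>wave_series m d x - wave_series m c x\<bar> < e" if "decay_moment m \<sigma> \<le> S" for m x
    proof -
      have "\<bar>wave_series m d x - wave_series m c x\<bar> \<le> r * decay_moment m \<sigma>"
        using wave_series_bound[OF s d, of m x] wave_series_diff[OF s dd c] by simp
      also have "\<dots> \<le> r * S" using that r(1) by simp
      finally show ?thesis using r(2) by simp
    qed
    then show "\<forall>x. \<bar>wave_series 0 d x - wave_series 0 c x\<bar> < e \<and>
        \<bar>wave_series 1 d x - wave_series 1 c x\<bar> < e \<and> \<bar>wave_series 2 d x - wave_series 2 c x\<bar> < e"
      using S by blast
  qed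
  then show ?thesis using r(1) by blast
qed

lemma morse_wave_series_by_first_coefficient:
  assumes s: "\<sigma> > 0" and c: "decays \<sigma> M c" and e: "e > 0"
  shows "\<exists>w. cmod w < e \<and> morse_distinct_values (wave_series 0 (c(1 := c 1 + w)))"
proof -
  have "(wave_series 2 c has_real_derivative wave_series 3 c x) (at x)" for x
    using wave_series_has_derivative[OF s c, of 2 x] by (simp add: eval_nat_numeral)
  then obtain w where w: "cmod w < e" "morse_distinct_values (\<lambda>x. wave_series 0 c x + Re (w * cis x))"
    using morse_distinct_values_by_wave[OF c2_circle_wave_series[OF s c] _ e] by blast
  have "wave_series 0 (c(1 := c 1 + w)) x = wave_series 0 c x + Re (w * cis x)" for x
  proof -
    have "c(1 := c 1 + w) = (\<lambda>j. c j - (if j = 1 then - w else 0))" by auto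
    then show ?thesis
      using wave_series_diff[OF s c decays_single[of \<sigma> "- w"], of 0 x] wave_series_single[of 0 "- w" x] by simp
  qed
  then have "wave_series 0 (c(1 := c 1 + w)) = (\<lambda>x. wave_series 0 c x + Re (w * cis x))" by (rule ext)
  then show ?thesis using w by auto
qed

lemma c2_circle_rescale:
  assumes "c2_circle F F1 F2"
  shows "c2_circle (\<lambda>x. F (x - p) / r) (\<lambda>x. F1 (x - p) / r) (\<lambda>x. F2 (x - p) / r)"
proof -
  have "((\<lambda>x. f (x - p) / r) has_real_derivative f' (x - p) / r) (at x)"
    if "\<And>x. (f has_real_derivative f' x) (at x)" for f f' x
  proof -
    have "((\<lambda>x. f (x - p)) has_real_derivative f' (x - p) * 1) (at x)"
      by (rule DERIV_chain'[OF _ that]) (auto intro!: derivative_eq_intros)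
    then show ?thesis by (auto intro: DERIV_cdivide)
  qed
  note D = this
  have "continuous_on UNIV (\<lambda>x. F2 (x - p))"
    by (rule continuous_on_compose2[of UNIV F2])
       (use assms in \<open>auto simp: c2_circle_def intro!: continuous_intros\<close>)
  then have C: "continuous_on UNIV (\<lambda>x. F2 (x - p) / r)"
    unfolding divide_inverse by (intro continuous_on_mult continuous_on_const)
  have shift: "x + 2 * pi * of_int m - p = (x - p) + 2 * pi * of_int m" for x and m :: int by simp
  show ?thesis
    unfolding c2_circle_def shift c2_circle_periodic[OF assms]
    using D[OF c2_circle_derivs(1)[OF assms]] D[OF c2_circle_derivs(2)[OF assms]] C by blast
qed

lemma morse_distinct_values_rescale:
  assumes F: "c2_circle F F1 F2" and r: "r \<noteq> 0"
    and morse: "morse_distinct_values (\<lambda>x. F (x - p) / r)"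
  shows "morse_distinct_values F"
  unfolding morse_distinct_values_iff[OF F] nondegenerate_def
proof (intro conjI allI impI)
  have m: "\<And>x. F1 (x - p) / r = 0 \<Longrightarrow> F2 (x - p) / r \<noteq> 0"
    "\<And>x y. F1 (x - p) / r = 0 \<Longrightarrow> F1 (y - p) / r = 0 \<Longrightarrow> \<not> same_angle x y \<Longrightarrow> F (x - p) / r \<noteq> F (y - p) / r"
    using morse unfolding morse_distinct_values_iff[OF c2_circle_rescale[OF F]] nondegenerate_def by blast+
  show "F2 x \<noteq> 0" if "F1 x = 0" for x
    using m(1)[of "x + p"] that by auto
  show "F x \<noteq> F y" if "F1 x = 0 \<and> F1 y = 0 \<and> \<not> same_angle x y" for x y
    using m(2)[of "x + p" "y + p"] that by (auto simp: same_angle_def)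
qed

text \<open>
  Write \<open>c 1\<close> as \<open>r * cis p\<close>.  Shifted by \<open>p\<close> and divided by \<open>r\<close>, the first harmonic is exactly the
  cosine, while the harmonics from the second on are of relative size \<open>exp (- 2 * \<sigma>) / exp (- \<sigma>)\<close>.  The
  threshold depends only on \<open>\<delta>\<close> and \<open>M\<close>, which makes the openness uniform over all but finitely
  many rays.
\<close>

lemma morse_wave_series_dominant:
  assumes \<delta>: "\<delta> > 0" and M: "M \<ge> 0"
  shows "\<exists>\<sigma>\<^sub>0. \<forall>\<sigma> c. \<sigma> \<ge> \<sigma>\<^sub>0 \<and> decays \<sigma> M c \<and> c 0 = 0 \<and> cmod (c 1) \<ge> \<delta> * exp (- \<sigma>)
           \<longrightarrow> morse_distinct_values (wave_series 0 c)"
proof -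
  obtain e where e: "e > 0" "\<And>G G1 G2. c2_circle G G1 G2 \<Longrightarrow>
      (\<forall>x. \<bar>G x - cos x\<bar> < e \<and> \<bar>G1 x - - sin x\<bar> < e \<and> \<bar>G2 x - - cos x\<bar> < e)
      \<Longrightarrow> morse_distinct_values G"
    using morse_distinct_values_stable[OF morse_distinct_values_cos] by blast
  define S where "S = decay_moment 0 1 + decay_moment 1 1 + decay_moment 2 1"
  have S: "decay_moment 0 1 \<le> S" "decay_moment 1 1 \<le> S" "decay_moment 2 1 \<le> S" "S \<ge> 0"
    using decay_moment_nonneg[of 1] by (simp_all add: S_def)
  define K where "K = M * exp 2 * S / \<delta>"
  define \<sigma>\<^sub>0 where "\<sigma>\<^sub>0 = max 1 (K / e)"
  have "morse_distinct_values (wave_series 0 c)"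
    if \<sigma>: "\<sigma> \<ge> \<sigma>\<^sub>0" and c: "decays \<sigma> M c" and c0: "c 0 = 0" and c1: "cmod (c 1) \<ge> \<delta> * exp (- \<sigma>)" for \<sigma> c
  proof -
    have s: "\<sigma> > 0" "\<sigma> \<ge> 1" using \<sigma> by (auto simp: \<sigma>\<^sub>0_def)
    define r where "r = cmod (c 1)"
    define p where "p = Arg (c 1)"
    have r: "r \<ge> \<delta> * exp (- \<sigma>)" using c1 by (simp add: r_def)
    have "0 < \<delta> * exp (- \<sigma>)" using \<delta> by simp
    then have r_pos: "r > 0" using r by (rule less_le_trans)
    have polar: "c 1 = of_real r * cis p"
      using rcis_cmod_Arg[of "c 1"] by (simp add: r_def p_def rcis_def)
    define d where "d = (\<lambda>j. c j - (if j = 1 then c 1 else 0))"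
    have d: "decays 1 (M * exp (2 - 2 * \<sigma>)) d"
      unfolding decays_def
    proof
      fix j
      show "cmod (d j) \<le> M * exp (2 - 2 * \<sigma>) * exp (- 1 * real j)"
      proof (cases "j \<le> 1")
        case True
        then have "d j = 0" using c0 by (cases j) (auto simp: d_def)
        then show ?thesis using M by simp
      next
        case False
        have "\<sigma> * (real j - 2) \<ge> 1 * (real j - 2)"
          using False s(2) by (intro mult_right_mono) auto
        then have "- \<sigma> * real j \<le> (2 - 2 * \<sigma>) + (- 1 * real j)"
          by (simp add: algebra_simps)
        then have "exp (- \<sigma> * real j) \<le> exp (2 - 2 * \<sigma>) * exp (- 1 * real j)"
          by (simp add: exp_add[symmetric])
        then have "M * exp (- \<sigma> * real j) \<le> M * (exp (2 - 2 * \<sigma>) * exp (- 1 * real j))"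
          using M by (rule mult_left_mono)
        moreover have "cmod (d j) \<le> M * exp (- \<sigma> * real j)"
          using c False by (auto simp: d_def decays_def)
        ultimately show ?thesis by (simp only: mult.assoc)
      qed
    qed
    have small: "\<bar>wave_series m c (x - p) / r - Re (\<i> ^ m * cis x)\<bar> < e" if "decay_moment m 1 \<le> S" for m x
    proof -
      have "wave_series m c (x - p) - Re (\<i> ^ m * c 1 * cis (x - p)) = wave_series m d (x - p)"
        unfolding d_def wave_series_diff[OF s(1) c decays_single] wave_series_single ..
      moreover have "Re (\<i> ^ m * c 1 * cis (x - p)) = r * Re (\<i> ^ m * cis x)"
      proof -
        have "\<i> ^ m * c 1 * cis (x - p) = of_real r * (\<i> ^ m * cis x)"
          unfolding polar by (simp add: mult_ac cis_mult)
        then show ?thesis by (simp only: times_complex.sel Re_complex_of_real Im_complex_of_real mult_zero_left diff_zero)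
      qed
      ultimately have "wave_series m c (x - p) - r * Re (\<i> ^ m * cis x) = wave_series m d (x - p)"
        by (simp only:)
      then have "wave_series m c (x - p) / r - Re (\<i> ^ m * cis x) = wave_series m d (x - p) / r"
        using r_pos by (simp add: field_simps del: times_complex.sel)
      also have "\<bar>\<dots>\<bar> \<le> M * exp (2 - 2 * \<sigma>) * decay_moment m 1 / r"
        using wave_series_bound[OF _ d, of m "x - p"] r_pos by (simp add: divide_right_mono)
      also have "\<dots> \<le> M * exp (2 - 2 * \<sigma>) * S / r"
        using that r_pos M by (intro divide_right_mono mult_left_mono) auto
      also have "\<dots> \<le> M * exp (2 - 2 * \<sigma>) * S / (\<delta> * exp (- \<sigma>))"
        using r r_pos S(4) M \<delta> by (intro divide_left_mono) auto
      \<comment> \<open>One of the two factors \<open>exp (- \<sigma>)\<close> of the remainder is used up by the lower bound on \<open>r\<close>.\<close>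
      also have "\<dots> = K * exp (- \<sigma>)"
      proof -
        have "exp (2 - 2 * \<sigma>) = exp 2 * exp (- \<sigma>) * exp (- \<sigma>)" by (simp add: exp_add[symmetric])
        then show ?thesis using \<delta> by (simp add: K_def)
      qed
      also have "\<dots> < e"
      proof -
        have "K / e \<le> \<sigma>" using \<sigma> by (simp add: \<sigma>\<^sub>0_def)
        also have "\<sigma> < exp \<sigma>" using exp_ge_add_one_self[of \<sigma>] by linarith
        finally show ?thesis using e(1) by (simp add: exp_minus field_simps)
      qed
      finally show ?thesis .
    qed
    have "Re (\<i> ^ 0 * cis x) = cos x" "Re (\<i> ^ 1 * cis x) = - sin x" "Re (\<i> ^ 2 * cis x) = - cos x" for x
      by simp_all
    then have "\<forall>x. \<bar>wave_series 0 c (x - p) / r - cos x\<bar> < e \<and> \<bar>wave_series 1 c (x - p) / r - - sin x\<bar> < e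
        \<and> \<bar>wave_series 2 c (x - p) / r - - cos x\<bar> < e"
      using small[OF S(1)] small[OF S(2)] small[OF S(3)] by metis
    then have "morse_distinct_values (\<lambda>x. wave_series 0 c (x - p) / r)"
      by (rule e(2)[OF c2_circle_rescale[OF c2_circle_wave_series[OF s(1) c]]])
    then show ?thesis
      by (rule morse_distinct_values_rescale[OF c2_circle_wave_series[OF s(1) c] less_imp_neq[OF r_pos, symmetric]])
  qed
  then show ?thesis by blast
qed


section \<open>Fourier synthesis on the torus\<close>

lemma norm_phase [simp]: "cmod (phase k x) = 1"
  by (simp add: phase_def)

lemma phase_zero [simp]: "phase 0 x = 1"
  by (simp add: phase_def)

lemma phase_add_frequency: "phase (k + l) x = phase k x * phase l x"
  by (simp add: phase_def exp_add[symmetric] sum.distrib ring_distribs)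

lemma phase_add: "phase k (x + y) = phase k x * phase k y"
  by (simp add: phase_def exp_add[symmetric] sum.distrib ring_distribs)

lemma phase_lattice: "phase k (\<chi> j. 2 * pi * of_int (m $ j)) = 1"
proof -
  have "(\<Sum>j\<in>UNIV. of_int (k $ j) * (2 * pi * of_int (m $ j))) = of_int (\<Sum>j\<in>UNIV. k $ j * m $ j) * (2 * pi)"
    by (simp add: sum_distrib_left sum_distrib_right mult_ac)
  then have "phase k (\<chi> j. 2 * pi * of_int (m $ j)) = cis (2 * pi * of_int (\<Sum>j\<in>UNIV. k $ j * m $ j))"
    unfolding phase_def cis_conv_exp by (simp only: vec_lambda_beta mult.commute)
  then show ?thesis by (simp del: of_int_sum)
qed

lemma continuous_on_phase [continuous_intros]: "continuous_on S (phase k)"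
  unfolding phase_def[abs_def] by (intro continuous_intros)

lemma phase_axis: "phase k (axis j t) = cis (of_int (k $ j) * t)"
proof -
  have "(\<Sum>i\<in>UNIV. of_int (k $ i) * axis j t $ i) = of_int (k $ j) * t"
    by (subst sum.remove[of _ j]) (auto simp: axis_def intro!: sum.neutral)
  then show ?thesis by (simp add: phase_def cis_conv_exp)
qed

text \<open>
  Translation by half a period in a direction \<open>j\<close> with \<open>k $ j \<noteq> 0\<close> changes the sign of the integrand.  It
  does not change the integral over a full cell, as seen by cutting one larger box \<open>D\<close> in two ways.
\<close>

lemma integral_phase_nonzero:
  fixes k :: "int ^ 'n"
  assumes "k \<noteq> 0"
  shows "integral torus_cell (phase k) = 0"
proof -
  obtain j where j: "k $ j \<noteq> 0" using assms by (auto simp: vec_eq_iff)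
  define t where "t = pi / \<bar>of_int (k $ j)\<bar>"
  have t: "t > 0" "t \<le> pi" using j by (auto simp: t_def field_simps)
  define e :: "real ^ 'n" where "e = axis j 1"
  define b :: "real ^ 'n" where "b = (\<chi> j. 2 * pi)"
  \<comment> \<open>The slab of the cell below height \<open>t\<close> in direction \<open>j\<close>; its translate by \<open>2 * pi\<close> is the other end of \<open>D\<close>.\<close>
  define A where "A = cbox 0 (\<chi> i. if i = j then t else 2 * pi)"
  let ?D = "cbox 0 (b + t *\<^sub>R e)"
  have te: "r *\<^sub>R e = axis j r" for r by (simp add: e_def vec_eq_iff axis_def)
  have half: "phase k (t *\<^sub>R e) = - 1"
  proof -
    have "phase k (t *\<^sub>R e) = cis (of_int (k $ j) * t)"
      by (simp add: te phase_axis)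
    also have "of_int (k $ j) * t = (if k $ j > 0 then pi else - pi)"
      using j by (auto simp: t_def)
    finally show ?thesis by (auto simp: complex_eq_iff)
  qed
  have full: "phase k ((2 * pi) *\<^sub>R e) = 1"
    using cis_multiple_2pi[of "of_int (k $ j)"] by (simp add: te phase_axis mult.commute)
  have int: "phase k integrable_on cbox u v" for u v
    by (intro integrable_continuous continuous_intros)
  have e_nth: "e $ i = (if i = j then 1 else 0)" for i by (simp add: e_def axis_def)
  have e_basis: "e \<in> Basis" by (simp add: e_def axis_in_Basis_iff)
  have x_e: "x \<bullet> e = x $ j" for x by (simp add: e_def inner_axis)
  have shift: "integral (cbox (u + v) (w + v)) (phase k) = phase k v * integral (cbox u w) (phase k)" for u v w
  proof -
    have "phase k \<circ> (+) v = (\<lambda>x. phase k v * phase k x)" by (simp add: fun_eq_iff phase_add)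
    then show ?thesis using integral_shift_cbox_plus[of u w "phase k" v] by simp
  qed
  have "integral ?D (phase k) = integral A (phase k) + integral (cbox (0 + t *\<^sub>R e) (b + t *\<^sub>R e)) (phase k)"
  proof -
    have "?D \<inter> {x. x \<bullet> e \<le> t} = A" "?D \<inter> {x. x \<bullet> e \<ge> t} = cbox (0 + t *\<^sub>R e) (b + t *\<^sub>R e)"
      using t by (intro set_eqI; simp add: x_e A_def mem_box_cart b_def e_nth; smt (verit))+
    then show ?thesis using integral_split[OF int e_basis, of 0 "b + t *\<^sub>R e" t] by simp
  qed
  moreover have "integral ?D (phase k) = integral (cbox 0 b) (phase k) + integral (cbox (0 + (2 * pi) *\<^sub>R e) ((\<chi> i. if i = j then t else 2 * pi) + (2 * pi) *\<^sub>R e)) (phase k)"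
  proof -
    have "?D \<inter> {x. x \<bullet> e \<le> 2 * pi} = cbox 0 b"
      "?D \<inter> {x. x \<bullet> e \<ge> 2 * pi} = cbox (0 + (2 * pi) *\<^sub>R e) ((\<chi> i. if i = j then t else 2 * pi) + (2 * pi) *\<^sub>R e)"
      using t by (intro set_eqI; simp add: x_e mem_box_cart b_def e_nth; smt (verit))+
    then show ?thesis using integral_split[OF int e_basis, of 0 "b + t *\<^sub>R e" "2 * pi"] by simp
  qed
  ultimately have "integral (cbox 0 b) (phase k) = - integral (cbox 0 b) (phase k)"
    unfolding shift half full by (simp add: A_def)
  then show ?thesis by (simp add: torus_cell_def b_def)
qed

lemma has_integral_phase:
  fixes k :: "int ^ 'n"
  shows "(phase k has_integral (if k = 0 then complex_of_real ((2 * pi) ^ CARD('n)) else 0)) torus_cell"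
proof (cases "k = 0")
  case True
  have "measure lborel (torus_cell :: (real ^ 'n) set) = (2 * pi) ^ CARD('n)"
    unfolding torus_cell_def by (subst content_cbox_cart) (auto simp: interval_ne_empty_cart)
  then have "((\<lambda>x::real^'n. 1::complex) has_integral of_real ((2 * pi) ^ CARD('n))) torus_cell"
    using has_integral_const[of "1::complex" "0 :: real ^ 'n" "\<chi> j. 2 * pi"]
    by (simp add: torus_cell_def scaleR_conv_of_real)
  moreover have "phase (0 :: int ^ 'n) = (\<lambda>x. 1)" by (simp add: fun_eq_iff)
  ultimately show ?thesis using True by simp
next
  case False
  have "phase k integrable_on torus_cell"
    unfolding torus_cell_def by (intro integrable_continuous continuous_intros)
  then show ?thesis using integral_phase_nonzero[OF False] False by (simp add: has_integral_iff)
qed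

lemma summable_exp_abs_int:
  fixes s :: real
  assumes "s > 0"
  shows "(\<lambda>j::int. exp (- s * of_int \<bar>j\<bar>)) summable_on UNIV"
proof -
  have geo: "(\<lambda>n::nat. exp (- s * real n)) summable_on UNIV"
  proof (rule norm_summable_imp_summable_on)
    have "summable (\<lambda>n. exp (- s) ^ n)" using assms by (intro summable_geometric) simp
    then show "summable (\<lambda>n. norm (exp (- s * real n)))"
      by (simp add: exp_of_nat_mult[symmetric] mult.commute)
  qed
  have 1: "(\<lambda>j::int. exp (- s * of_int \<bar>j\<bar>)) summable_on range int"
    using geo by (subst summable_on_reindex) (auto simp: o_def)
  have 2: "(\<lambda>j::int. exp (- s * of_int \<bar>j\<bar>)) summable_on range (\<lambda>n. - int n)"
    using geo by (subst summable_on_reindex) (auto simp: o_def inj_def)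
  have "j \<in> range int \<union> (range (\<lambda>n. - int n) - range int)" for j
    by (cases j rule: int_cases2) auto
  then have "UNIV = range int \<union> (range (\<lambda>n. - int n) - range int)" by blast
  then show ?thesis
    using summable_on_Un_disjoint[OF 1 summable_on_subset_banach[OF 2, of "range (\<lambda>n. - int n) - range int"]]
    by auto
qed

lemma norm_summable_prod:
  fixes f :: "'a :: finite \<Rightarrow> 'b :: countable \<Rightarrow> 'c :: {real_normed_field, banach, second_countable_topology}"
  assumes "\<And>x. (\<lambda>m. norm (f x m)) summable_on UNIV"
  shows "(\<lambda>g. norm (\<Prod>x\<in>UNIV. f x (g x))) summable_on UNIV"
proof -
  have "Infinite_Set_Sum.abs_summable_on (\<lambda>g. \<Prod>x\<in>UNIV. f x (g x)) (PiE UNIV (\<lambda>_. UNIV))"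
    by (intro abs_summable_on_prod_PiE) (use assms in \<open>auto simp: abs_summable_equivalent[symmetric]\<close>)
  then show ?thesis by (simp add: abs_summable_equivalent[symmetric] PiE_UNIV_domain)
qed

lemma summable_exp_l1norm:
  fixes s :: real
  assumes "s > 0"
  shows "(\<lambda>k :: int ^ 'n. exp (- s * of_int (l1norm k))) summable_on UNIV"
proof -
  have "(\<lambda>g :: 'n \<Rightarrow> int. \<Prod>i\<in>UNIV. exp (- s * of_int \<bar>g i\<bar>)) summable_on UNIV"
    using norm_summable_prod[of "\<lambda>(_::'n) (j::int). exp (- s * of_int \<bar>j\<bar>)"] summable_exp_abs_int[OF assms]
    by (simp add: prod_nonneg)
  also have "(\<lambda>g :: 'n \<Rightarrow> int. \<Prod>i\<in>UNIV. exp (- s * of_int \<bar>g i\<bar>)) = (\<lambda>g. exp (- s * of_int (l1norm (vec_lambda g :: int ^ 'n))))"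
    by (simp add: l1norm_def exp_sum[symmetric] sum_distrib_left sum_negf)
  finally show ?thesis
    by (subst (asm) summable_on_reindex_bij_betw[where g = vec_lambda and B = UNIV])
       (auto intro!: bij_betwI[of _ _ _ "\<lambda>k i. k $ i"])
qed

lemma has_sum_exp:
  fixes z :: "'a :: {real_normed_field, banach}"
  shows "((\<lambda>m. z ^ m / fact m) has_sum exp z) UNIV"
proof -
  have eq: "z ^ m / fact m = z ^ m /\<^sub>R fact m" for m
    by (simp add: scaleR_conv_of_real field_simps)
  show ?thesis
    unfolding eq by (intro norm_summable_imp_has_sum summable_norm_exp exp_converges)
qed

lemma has_sum_exp_multi:
  fixes z :: "'n :: finite \<Rightarrow> 'a :: {real_normed_field, banach, second_countable_topology}"
  shows "((\<lambda>\<alpha>. \<Prod>j\<in>UNIV. z j ^ \<alpha> j / fact (\<alpha> j)) has_sum exp (\<Sum>j\<in>UNIV. z j)) UNIV"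
proof -
  have abs: "(\<lambda>m. norm (y ^ m / fact m)) summable_on UNIV" for y :: 'a
    using has_sum_exp[of "norm y"] by (auto simp: norm_divide norm_power summable_on_def)
  have "(\<lambda>\<alpha>. \<Prod>j\<in>UNIV. z j ^ \<alpha> j / fact (\<alpha> j)) summable_on UNIV"
    by (rule abs_summable_summable, rule norm_summable_prod, rule abs)
  moreover have "(\<Sum>\<^sub>\<infinity>\<alpha>\<in>PiE UNIV (\<lambda>_. UNIV). \<Prod>j\<in>UNIV. z j ^ \<alpha> j / fact (\<alpha> j))
      = (\<Prod>j\<in>UNIV. \<Sum>\<^sub>\<infinity>m. z j ^ m / fact m)"
    by (rule infsum_prod_PiE_abs) (use abs in auto)
  ultimately show ?thesis
    by (simp add: infsumI[OF has_sum_exp] exp_sum PiE_UNIV_domain has_sum_iff)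
qed

definition fourier_synthesis :: "(int ^ 'n \<Rightarrow> complex) \<Rightarrow> real ^ 'n \<Rightarrow> real" where
  "fourier_synthesis c x = Re (\<Sum>\<^sub>\<infinity>k. c k * phase k x)"

text \<open>
  The symmetry of the coefficients makes the sum equal to its own conjugate, so that taking the real part in
  the definition loses nothing.
\<close>

lemma has_sum_fourier_synthesis:
  fixes c :: "int ^ 'n \<Rightarrow> complex"
  assumes s: "s > 0" and c: "\<And>k. cmod (c k) \<le> M * exp (- s * of_int (l1norm k))"
    and real: "\<And>k. c (- k) = cnj (c k)"
  shows "((\<lambda>k. c k * phase k x) has_sum of_real (fourier_synthesis c x)) UNIV"
proof -
  define t where "t k = c k * phase k x" for k
  have "(\<lambda>k. norm (t k)) summable_on UNIV"
    by (rule summable_on_comparison_test[OF summable_on_cmult_right[OF summable_exp_l1norm[OF s], of M]])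
       (use c in \<open>auto simp: t_def norm_mult\<close>)
  then have sum: "(t has_sum infsum t UNIV) UNIV"
    by (rule has_sum_infsum[OF abs_summable_summable])
  have neg: "t (- k) = cnj (t k)" for k
    by (simp add: t_def real phase_neg)
  have "infsum t UNIV = (\<Sum>\<^sub>\<infinity>k. t (- k))"
    by (rule infsum_reindex_bij_betw[symmetric]) (simp add: bij_uminus)
  also have "\<dots> = cnj (infsum t UNIV)"
    by (simp add: neg)
  finally have "of_real (Re (infsum t UNIV)) = infsum t UNIV"
    by (simp add: complex_eq_iff)
  then show ?thesis
    using sum by (simp add: fourier_synthesis_def t_def[abs_def])
qed

text \<open>
  Expand \<open>phase k (x + h) = phase k x * phase k h\<close>, the second factor being a product of exponential
  series in the \<open>h $ j\<close>.  For \<open>\<bar>h $ j\<bar> < s / 2\<close> the absolute double series over frequencies and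
  multi-indices is dominated by \<open>M * exp (- s * l1norm k) * exp (s / 2 * l1norm k)\<close>, so the two summations
  may be exchanged.
\<close>

lemma real_analytic_fourier_synthesis:
  fixes c :: "int ^ 'n \<Rightarrow> complex"
  assumes s: "s > 0" and c: "\<And>k. cmod (c k) \<le> M * exp (- s * of_int (l1norm k))"
    and real: "\<And>k. c (- k) = cnj (c k)"
  shows "real_analytic (fourier_synthesis c)"
  unfolding real_analytic_def
proof (intro allI exI conjI impI)
  show "s / 2 > 0" using s by simp
  fix x h :: "real ^ 'n"
  assume h: "\<forall>j. \<bar>h $ j\<bar> < s / 2"
  define b where "b k \<alpha> = c k * phase k x * (\<Prod>j\<in>UNIV. (\<i> * of_int (k $ j)) ^ \<alpha> j / fact (\<alpha> j))"
    for k and \<alpha> :: "'n \<Rightarrow> nat"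
  define H where "H \<alpha> = (\<Prod>j\<in>UNIV. (h $ j) ^ \<alpha> j)" for \<alpha>
  define z where "z k j = \<i> * of_int (k $ j) * of_real (h $ j)" for k :: "int ^ 'n" and j
  define T where "T = (\<lambda>(k, \<alpha>). b k \<alpha> * of_real (H \<alpha>))"
  have T: "T (k, \<alpha>) = c k * phase k x * (\<Prod>j\<in>UNIV. z k j ^ \<alpha> j / fact (\<alpha> j))" for k \<alpha>
    by (simp add: T_def b_def H_def z_def prod.distrib[symmetric] power_mult_distrib)
  have M: "M \<ge> 0"
    using c[of 0] order_trans[OF norm_ge_zero c[of 0]] by (simp add: l1norm_def)
  have row: "((\<lambda>\<alpha>. T (k, \<alpha>)) has_sum c k * phase k (x + h)) UNIV" for k
  proof -
    have "phase k h = exp (\<Sum>j\<in>UNIV. z k j)"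
      by (simp add: phase_def z_def sum_distrib_left mult_ac)
    then show ?thesis
      unfolding T phase_add mult.assoc[symmetric]
      using has_sum_cmult_right[OF has_sum_exp_multi[of "z k"], of "c k * phase k x"] by simp
  qed
  \<comment> \<open>The same expansion for the moduli sums to an exponential with a positive exponent.\<close>
  have norm_row: "((\<lambda>\<alpha>. norm (T (k, \<alpha>))) has_sum cmod (c k) * exp (\<Sum>j\<in>UNIV. cmod (z k j))) UNIV" for k
    unfolding T
    using has_sum_cmult_right[OF has_sum_exp_multi[of "\<lambda>j. cmod (z k j)"], of "cmod (c k)"]
    by (simp add: norm_mult norm_divide norm_power prod_norm[symmetric])
  have "cmod (c k) * exp (\<Sum>j\<in>UNIV. cmod (z k j)) \<le> M * exp (- (s / 2) * of_int (l1norm k))" for k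
  proof -
    have "(\<Sum>j\<in>UNIV. cmod (z k j)) \<le> (\<Sum>j\<in>UNIV. s / 2 * of_int \<bar>k $ j\<bar>)"
    proof (rule sum_mono)
      fix j
      have "cmod (z k j) = \<bar>h $ j\<bar> * of_int \<bar>k $ j\<bar>" by (simp add: z_def norm_mult)
      also have "\<dots> \<le> s / 2 * of_int \<bar>k $ j\<bar>"
        by (intro mult_right_mono less_imp_le[OF h[rule_format]]) simp
      finally show "cmod (z k j) \<le> s / 2 * of_int \<bar>k $ j\<bar>" .
    qed
    also have "\<dots> = s / 2 * of_int (l1norm k)" by (simp add: l1norm_def sum_distrib_left)
    finally have "cmod (c k) * exp (\<Sum>j\<in>UNIV. cmod (z k j))
        \<le> M * exp (- s * of_int (l1norm k)) * exp (s / 2 * of_int (l1norm k))"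
      using M by (intro mult_mono c) auto
    also have "\<dots> = M * exp (- (s / 2) * of_int (l1norm k))"
      by (simp add: mult.assoc exp_add[symmetric])
    finally show ?thesis .
  qed
  then have "(\<lambda>k. cmod (c k) * exp (\<Sum>j\<in>UNIV. cmod (z k j))) summable_on UNIV"
    using s by (intro summable_on_comparison_test[OF summable_on_cmult_right[OF summable_exp_l1norm[of "s / 2"], of M]]) auto
  then have "(\<lambda>p. norm (T p)) summable_on UNIV \<times> UNIV"
    using norm_row by (intro summable_on_SigmaI) auto
  then have T_sum: "T summable_on UNIV \<times> UNIV" by (rule abs_summable_summable)
  then obtain S where S: "(T has_sum S) (UNIV \<times> UNIV)" by (auto simp: summable_on_def)
  have "((\<lambda>k. c k * phase k (x + h)) has_sum S) UNIV"
    by (rule has_sum_Sigma'[OF S row])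
  then have S_eq: "S = of_real (fourier_synthesis c (x + h))"
    by (rule has_sum_unique[OF _ has_sum_fourier_synthesis[OF s c real]])
  have swap: "((\<lambda>(\<alpha>, k). T (k, \<alpha>)) has_sum S) (UNIV \<times> UNIV)"
    using S by (subst has_sum_swap[symmetric])
  have "(\<lambda>k. T (k, \<alpha>)) summable_on UNIV" for \<alpha>
    using summable_on_SigmaD1[of "\<lambda>\<alpha> k. T (k, \<alpha>)" UNIV "\<lambda>_. UNIV" \<alpha>] swap
    by (auto simp: summable_on_def)
  then have "((\<lambda>k. T (k, \<alpha>)) has_sum (\<Sum>\<^sub>\<infinity>k. T (k, \<alpha>))) UNIV" for \<alpha>
    by (rule has_sum_infsum)
  then have "((\<lambda>\<alpha>. \<Sum>\<^sub>\<infinity>k. T (k, \<alpha>)) has_sum S) UNIV"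
    by (intro has_sum_Sigma'[OF swap]) auto
  moreover have "(\<Sum>\<^sub>\<infinity>k. T (k, \<alpha>)) = (\<Sum>\<^sub>\<infinity>k. b k \<alpha>) * of_real (H \<alpha>)" for \<alpha>
    by (simp add: T_def infsum_cmult_left')
  ultimately have "((\<lambda>\<alpha>. Re ((\<Sum>\<^sub>\<infinity>k. b k \<alpha>) * of_real (H \<alpha>))) has_sum Re S) UNIV"
    by (intro has_sum_Re) simp
  moreover have "Re (y * of_real (H \<alpha>)) = Re y * H \<alpha>" for y \<alpha>
    by simp
  ultimately show "((\<lambda>\<alpha>. Re (\<Sum>\<^sub>\<infinity>k. c k * phase k x * (\<Prod>j\<in>UNIV. (\<i> * of_int (k $ j)) ^ \<alpha> j / fact (\<alpha> j)))
      * (\<Prod>j\<in>UNIV. h $ j ^ \<alpha> j)) has_sum fourier_synthesis c (x + h)) UNIV"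
    by (simp only: S_eq b_def H_def Re_complex_of_real)
qed

lemma torus_periodic_fourier_synthesis: "torus_periodic (fourier_synthesis c)"
  by (simp add: torus_periodic_def fourier_synthesis_def phase_add phase_lattice)

text \<open>
  The series converges uniformly, so it may be integrated term by term, and orthogonality leaves one term.
\<close>

lemma fourier_coeff_fourier_synthesis:
  fixes c :: "int ^ 'n \<Rightarrow> complex"
  assumes s: "s > 0" and c: "\<And>k. cmod (c k) \<le> M * exp (- s * of_int (l1norm k))"
    and real: "\<And>k. c (- k) = cnj (c k)"
  shows "fourier_coeff (fourier_synthesis c) l = c l"
proof -
  let ?V = "complex_of_real ((2 * pi) ^ CARD('n))"
  define g where "g x = complex_of_real (fourier_synthesis c x) * phase (- l) x" for x
  have "uniform_limit torus_cell (\<lambda>X x. \<Sum>k\<in>X. c k * phase k x * phase (- l) x) g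
      (finite_subsets_at_top UNIV)"
  proof (rule Weierstrass_m_test_general'[where M = "\<lambda>k. M * exp (- s * of_int (l1norm k))"])
    show "norm (c k * phase k x * phase (- l) x) \<le> M * exp (- s * of_int (l1norm k))" for k x
      using c by (simp add: norm_mult)
    show "((\<lambda>k. c k * phase k x * phase (- l) x) has_sum g x) UNIV" for x
      unfolding g_def by (intro has_sum_cmult_left has_sum_fourier_synthesis[OF s c real])
    show "(\<lambda>k :: int ^ 'n. M * exp (- s * of_int (l1norm k))) summable_on UNIV"
      by (intro summable_on_cmult_right summable_exp_l1norm s)
  qed
  then obtain I J where
    I: "\<And>X. ((\<lambda>x. \<Sum>k\<in>X. c k * phase k x * phase (- l) x) has_integral I X) torus_cell"
    and J: "(g has_integral J) torus_cell" and lim: "(I \<longlongrightarrow> J) (finite_subsets_at_top UNIV)"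
    unfolding torus_cell_def
    by (rule uniform_limit_integral_cbox) (auto intro!: continuous_intros)
  have "I X = c l * ?V" if "finite X" "l \<in> X" for X
  proof -
    have "((\<lambda>x. \<Sum>k\<in>X. c k * phase k x * phase (- l) x) has_integral
        (\<Sum>k\<in>X. c k * (if k - l = 0 then ?V else 0))) torus_cell"
    proof (rule has_integral_sum[OF that(1)])
      fix k
      have "(\<lambda>x. c k * phase k x * phase (- l) x) = (\<lambda>x. c k * phase (k - l) x)"
        using phase_add_frequency[of k "- l"] by (simp add: fun_eq_iff)
      then show "((\<lambda>x. c k * phase k x * phase (- l) x) has_integral c k * (if k - l = 0 then ?V else 0)) torus_cell"
        using has_integral_mult_right[OF has_integral_phase[of "k - l"], of "c k"] by (simp only:)
    qed
    also have "(\<Sum>k\<in>X. c k * (if k - l = 0 then ?V else 0)) = (\<Sum>k\<in>X. if k = l then c k * ?V else 0)"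
      by (intro sum.cong) auto
    also have "\<dots> = c l * ?V"
      using that by simp
    finally show ?thesis using has_integral_unique[OF I] by blast
  qed
  then have "\<forall>\<^sub>F X in finite_subsets_at_top UNIV. I X = c l * ?V"
    unfolding eventually_finite_subsets_at_top by (intro exI[of _ "{l}"]) auto
  then have "(I \<longlongrightarrow> c l * ?V) (finite_subsets_at_top UNIV)"
    by (rule tendsto_eventually)
  then have "J = c l * ?V" using lim by (intro tendsto_unique[OF _ lim]) auto
  then have "integral torus_cell g = c l * ?V" using J by (simp add: integral_unique)
  then show ?thesis by (simp add: fourier_coeff_def g_def[abs_def])
qed

lemma fourier_synthesis_in_analytic_space:
  fixes c :: "int ^ 'n \<Rightarrow> complex"
  assumes s: "s > 0" and c: "\<And>k. cmod (c k) \<le> M * exp (- s * of_int (l1norm k))"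
    and real: "\<And>k. c (- k) = cnj (c k)" and zero: "c 0 = 0"
  shows "fourier_synthesis c \<in> analytic_space s"
proof -
  note coeff = fourier_coeff_fourier_synthesis[OF s c real]
  note ana = real_analytic_fourier_synthesis[OF s c real]
  have "fourier_synthesis c integrable_on torus_cell"
    unfolding torus_cell_def
    using continuous_on_subset[OF real_analytic_imp_continuous[OF ana]]
    by (intro integrable_continuous) auto
  then have "integral torus_cell (\<lambda>x. complex_of_real (fourier_synthesis c x))
      = complex_of_real (integral torus_cell (fourier_synthesis c))"
    using integral_linear[OF _ bounded_linear_of_real] by (simp add: o_def)
  moreover have "integral torus_cell (\<lambda>x. complex_of_real (fourier_synthesis c x)) = 0"
    using coeff[of 0] zero by (simp add: fourier_coeff_def)
  ultimately have int: "integral torus_cell (fourier_synthesis c) = 0" by simp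
  have "fourier_norm s (fourier_synthesis c) \<le> ennreal M"
    unfolding fourier_norm_def coeff
  proof (intro SUP_least ennreal_leI)
    fix k :: "int ^ 'n"
    show "cmod (c k) * exp (of_int (l1norm k) * s) \<le> M"
      using c[of k] by (simp add: exp_minus field_simps)
  qed
  also have "\<dots> < \<infinity>" by simp
  finally show ?thesis
    using has_sum_fourier_synthesis[OF s c real] ana int torus_periodic_fourier_synthesis[of c]
    by (simp add: analytic_space_def coeff)
qed


section \<open>The open and dense set\<close>

lemma fourier_coeff_zero:
  assumes "f \<in> analytic_space s"
  shows "fourier_coeff f 0 = 0"
proof -
  have "continuous_on UNIV f"
    using assms real_analytic_imp_continuous by (auto simp: analytic_space_def)
  then have "f integrable_on torus_cell"
    unfolding torus_cell_def by (intro integrable_continuous) (rule continuous_on_subset, auto)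
  then have "integral torus_cell (\<lambda>x. complex_of_real (f x)) = complex_of_real (integral torus_cell f)"
    using integral_linear[OF _ bounded_linear_of_real] by (simp add: o_def)
  then show ?thesis using assms by (simp add: fourier_coeff_def analytic_space_def)
qed

lemma weighted_le_iff:
  "cmod z * exp (of_int (l1norm k) * s) \<le> r \<longleftrightarrow> cmod z \<le> r * exp (- s * of_int (l1norm k))"
  by (simp add: exp_minus field_simps)

lemma unit_ball_iff:
  "f \<in> unit_ball s \<longleftrightarrow> f \<in> analytic_space s \<and>
     (\<forall>k. cmod (fourier_coeff f k) \<le> exp (- s * of_int (l1norm k)))"
proof -
  have "fourier_norm s f \<le> 1 \<longleftrightarrow> (\<forall>k. cmod (fourier_coeff f k) * exp (of_int (l1norm k) * s) \<le> 1)"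
    by (simp add: fourier_norm_def SUP_le_iff)
  then show ?thesis by (simp add: unit_ball_def weighted_le_iff)
qed

lemma unit_ballD:
  assumes "f \<in> unit_ball s"
  shows "f \<in> analytic_space s" "cmod (fourier_coeff f k) \<le> exp (- s * of_int (l1norm k))"
  using assms by (auto simp: unit_ball_iff)

lemma fourier_coeff_dist:
  assumes "f \<in> analytic_space s" "g \<in> analytic_space s"
  shows "cmod (fourier_coeff f k - fourier_coeff g k) \<le> fourier_dist s f g * exp (- s * of_int (l1norm k))"
proof -
  let ?x = "cmod (fourier_coeff f k - fourier_coeff g k) * exp (of_int (l1norm k) * s)"
  have "ennreal ?x \<le> fourier_norm s (\<lambda>x. f x - g x)"
    unfolding fourier_norm_def fourier_coeff_diff[OF assms] by (rule SUP_upper) simp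
  then have "enn2real (ennreal ?x) \<le> fourier_dist s f g"
    unfolding fourier_dist_def using fourier_norm_diff_finite[OF assms] by (intro enn2real_mono) auto
  then show ?thesis by (simp add: weighted_le_iff)
qed

lemma fourier_dist_le:
  assumes "f \<in> analytic_space s" "g \<in> analytic_space s" "r \<ge> 0"
    and "\<And>k. cmod (fourier_coeff f k - fourier_coeff g k) \<le> r * exp (- s * of_int (l1norm k))"
  shows "fourier_dist s f g \<le> r"
proof -
  have "fourier_norm s (\<lambda>x. f x - g x) \<le> ennreal r"
    unfolding fourier_norm_def fourier_coeff_diff[OF assms(1,2)]
    using assms(4) by (intro SUP_least ennreal_leI) (simp only: weighted_le_iff)
  then have "fourier_dist s f g \<le> enn2real (ennreal r)"
    unfolding fourier_dist_def by (intro enn2real_mono) auto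
  then show ?thesis using assms(3) by simp
qed

lemma l1norm_scale: "l1norm (\<chi> i. j * k $ i) = \<bar>j\<bar> * l1norm k"
  by (simp add: l1norm_def abs_mult sum_distrib_left)

lemma l1norm_pos: "k \<noteq> 0 \<Longrightarrow> l1norm k \<ge> 1"
proof -
  assume "k \<noteq> 0"
  then have "l1norm k \<noteq> 0" by (auto simp: l1norm_def sum_nonneg_eq_0_iff vec_eq_iff)
  moreover have "l1norm k \<ge> 0" by (simp add: l1norm_def sum_nonneg)
  ultimately show ?thesis by simp
qed

lemma l1norm_minus [simp]: "l1norm (- k) = l1norm k"
  by (simp add: l1norm_def)

lemma finite_l1norm_le: "finite {k :: int ^ 'n. l1norm k \<le> N}"
proof (rule finite_subset)
  show "{k :: int ^ 'n. l1norm k \<le> N} \<subseteq> vec_lambda ` (PiE UNIV (\<lambda>_. {- N..N}))"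
  proof
    fix k :: "int ^ 'n" assume "k \<in> {k. l1norm k \<le> N}"
    moreover have "\<bar>k $ i\<bar> \<le> l1norm k" for i
      unfolding l1norm_def by (rule member_le_sum) auto
    ultimately have "\<bar>k $ i\<bar> \<le> N" for i by (metis mem_Collect_eq order_trans)
    then have "(\<lambda>i. k $ i) \<in> PiE UNIV (\<lambda>_. {- N..N})" by (auto simp: abs_le_iff minus_le_iff)
    then show "k \<in> vec_lambda ` (PiE UNIV (\<lambda>_. {- N..N}))"
      by (intro image_eqI[of _ _ "\<lambda>i. k $ i"]) (simp_all add: vec_nth_inverse)
  qed
qed (intro finite_imageI finite_PiE, auto)

lemma generators_nonzero: "k \<in> generators \<Longrightarrow> k \<noteq> 0"
  unfolding generators_def by blast

lemma generators_pos: "k \<in> generators \<Longrightarrow> l1norm k \<ge> 1"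
  by (intro l1norm_pos generators_nonzero)

lemma generators_minus: "k \<in> generators \<Longrightarrow> - k \<notin> generators"
proof
  assume "k \<in> generators" "- k \<in> generators"
  then obtain i j where "k $ i > 0" "\<forall>l<i. k $ l = 0" "k $ j < 0" "\<forall>l<j. k $ l = 0"
    by (auto simp: generators_def)
  then show False by (cases i j rule: linorder_cases) auto
qed

text \<open>
  A generator and its negative are the only primitive points on their line, so adjusting the coefficients at
  generators changes exactly the first harmonic of each projection.
\<close>

lemma generators_multiple:
  assumes "\<bar>j\<bar> \<noteq> 1"
  shows "(\<chi> i. j * k $ i) \<notin> generators" "- (\<chi> i. j * k $ i) \<notin> generators"
proof -
  have "j dvd Gcd (range (\<lambda>i. l $ i))" if "\<And>i. j dvd l $ i" for l :: "int ^ 'n :: {finite, linorder}"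
    using that by (intro Gcd_greatest) auto
  then have multiple: "l \<notin> generators" if "\<And>i. j dvd l $ i" for l :: "int ^ 'n :: {finite, linorder}"
    using that assms by (fastforce simp: generators_def)
  show "(\<chi> i. j * k $ i) \<notin> generators" "- (\<chi> i. j * k $ i) \<notin> generators"
    by (rule multiple, simp)+
qed

text \<open>
  The factor 2 comes from adding the harmonics \<open>n\<close> and \<open>- n\<close>, which are conjugate to each other.
\<close>

definition ray_coeffs :: "(real ^ 'n \<Rightarrow> real) \<Rightarrow> int ^ 'n \<Rightarrow> nat \<Rightarrow> complex" where
  "ray_coeffs f k n = 2 * fourier_coeff f (\<chi> i. int n * k $ i)"

lemma ray_coeffs_1: "ray_coeffs f k 1 = 2 * fourier_coeff f k"
  by (simp add: ray_coeffs_def)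

lemma ray_coeffs_0: "f \<in> analytic_space s \<Longrightarrow> ray_coeffs f k 0 = 0"
  using fourier_coeff_zero[of f s] by (simp add: ray_coeffs_def zero_vec_def)

lemma decays_ray_coeffs:
  assumes "f \<in> unit_ball s"
  shows "decays (s * of_int (l1norm k)) 2 (ray_coeffs f k)"
  unfolding decays_def
proof
  fix n
  show "cmod (ray_coeffs f k n) \<le> 2 * exp (- (s * of_int (l1norm k)) * real n)"
    using unit_ballD(2)[OF assms, of "\<chi> i. int n * k $ i"]
    by (simp add: ray_coeffs_def norm_mult l1norm_scale mult_ac)
qed

lemma ray_projection_eq_wave_series:
  assumes f: "f \<in> unit_ball s" and s: "s > 0" and k: "k \<noteq> 0"
  shows "ray_projection f k = wave_series 0 (ray_coeffs f k)"
proof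
  fix \<theta>
  define t where "t j = fourier_coeff f (\<chi> i. j * k $ i) * exp (\<i> * of_int j * of_real \<theta>)" for j :: int
  define S where "S = (\<Sum>\<^sub>\<infinity>n. t (int n))"
  have \<sigma>: "s * of_int (l1norm k) > 0" using s l1norm_pos[OF k] by simp
  have t0: "t 0 = 0"
    using fourier_coeff_zero[OF unit_ballD(1)[OF f]] by (simp add: t_def zero_vec_def)
  have neg: "t (- j) = cnj (t j)" for j
  proof -
    have "(\<chi> i. - j * k $ i) = - (\<chi> i. j * k $ i)" by (simp add: vec_eq_iff)
    then show ?thesis by (simp add: t_def fourier_coeff_neg exp_cnj)
  qed
  have wave: "ray_coeffs f k n * cis (real n * \<theta>) = 2 * t (int n)" for n
    by (simp add: ray_coeffs_def t_def cis_conv_exp mult_ac)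
  have "summable (\<lambda>n. norm (t (int n)))"
  proof (rule summable_comparison_test')
    show "summable (\<lambda>n. 2 * (real n ^ 0 * exp (- (s * of_int (l1norm k)) * real n)))"
      by (rule summable_mult[OF summable_decay_moment[OF \<sigma>]])
    have "norm (t (int n)) \<le> norm (ray_coeffs f k n * cis (real n * \<theta>))" for n
      unfolding wave by (simp add: norm_mult)
    also have "norm (ray_coeffs f k n * cis (real n * \<theta>)) \<le> 2 * exp (- (s * of_int (l1norm k)) * real n)" for n
      using decays_ray_coeffs[OF f, of k] by (simp add: decays_def norm_mult)
    finally show "norm (norm (t (int n))) \<le> 2 * (real n ^ 0 * exp (- (s * of_int (l1norm k)) * real n))" for n
      by simp
  qed
  then have "(\<lambda>n. t (int n)) summable_on UNIV"
    by (rule norm_summable_imp_summable_on)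
  then have S: "((\<lambda>n. t (int n)) has_sum S) UNIV"
    unfolding S_def by (rule has_sum_infsum)
  then have "(t has_sum S) (range int)"
    by (subst has_sum_reindex) (auto simp: o_def)
  \<comment> \<open>As \<open>t 0 = 0\<close>, the index 0 can be dropped here and restored at the end.\<close>
  also have "?this \<longleftrightarrow> (t has_sum S) {0<..}"
  proof (rule has_sum_cong_neutral)
    show "t x = 0" if "x \<in> range int - {0<..}" for x using that t0 by auto
    show "t x = 0" if "x \<in> {0<..} - range int" for x
      using that nonneg_int_cases[of x] by fastforce
  qed simp
  finally have P: "(t has_sum S) {0<..}" .
  then have "((\<lambda>j. t (- j)) has_sum cnj S) {0<..}"
    unfolding neg by (simp only: has_sum_cnj_iff)
  also have "?this \<longleftrightarrow> (t has_sum cnj S) {..<0}"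
    by (rule has_sum_reindex_bij_betw) (auto intro!: bij_betwI[of _ _ _ uminus])
  finally have "(t has_sum (S + cnj S)) ({0<..} \<union> {..<0})"
    using P by (intro has_sum_Un_disjoint) auto
  also have "?this \<longleftrightarrow> (t has_sum (S + cnj S)) UNIV"
    by (rule has_sum_cong_neutral) (use t0 in \<open>auto simp: not_less\<close>)
  finally have "ray_projection f k \<theta> = Re (S + cnj S)"
    unfolding ray_projection_def t_def[symmetric] by (simp add: infsumI)
  moreover have "(\<lambda>n. Re (2 * t (int n))) sums Re (2 * S)"
    by (intro sums_Re sums_mult has_sum_imp_sums S)
  then have "wave_series 0 (ray_coeffs f k) \<theta> = Re (2 * S)"
    unfolding wave_series_def power_0 mult_1 wave by (rule sums_unique[symmetric])
  ultimately show "ray_projection f k \<theta> = wave_series 0 (ray_coeffs f k) \<theta>" by simp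
qed

definition robust_set :: "real \<Rightarrow> (real ^ 'n :: {finite, linorder} \<Rightarrow> real) set" where
  "robust_set s = {f \<in> unit_ball s.
     (\<exists>\<delta>>0. \<forall>k\<in>generators. cmod (fourier_coeff f k) \<ge> \<delta> * exp (- s * of_int (l1norm k))) \<and>
     (\<forall>k\<in>generators. morse_distinct_values (ray_projection f k))}"

lemma robust_set_subset_generic_set:
  "robust_set s \<subseteq> (generic_set s :: (real ^ 'n :: {finite, linorder} \<Rightarrow> real) set)"
proof
  fix f :: "(real, 'n) vec \<Rightarrow> real"
  assume f: "f \<in> robust_set s"
  then obtain \<delta> where \<delta>: "\<delta> > 0"
    "\<And>k. k \<in> generators \<Longrightarrow> \<delta> * exp (- s * of_int (l1norm k)) \<le> cmod (fourier_coeff f k)"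
    by (auto simp: robust_set_def)
  let ?F = "inf (filtercomap l1norm at_top) (principal generators) :: (int, 'n) vec filter"
  have "ereal \<delta> \<le> ereal (cmod (fourier_coeff f k) * exp (of_int (l1norm k) * s) * of_int (l1norm k) ^ CARD('n))"
    if "k \<in> generators" for k
  proof -
    have "\<delta> \<le> cmod (fourier_coeff f k) * exp (of_int (l1norm k) * s)"
      using \<delta>(2)[OF that] by (simp add: exp_minus field_simps)
    moreover have "(1::real) \<le> of_int (l1norm k) ^ CARD('n)"
      using generators_pos[OF that] by (intro one_le_power) simp
    ultimately have "\<delta> * 1 \<le> cmod (fourier_coeff f k) * exp (of_int (l1norm k) * s) * of_int (l1norm k) ^ CARD('n)"
      using \<delta>(1) by (intro mult_mono) auto
    then show ?thesis by simp
  qed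
  then have "ereal \<delta> \<le> Liminf ?F (\<lambda>k. ereal (cmod (fourier_coeff f k) * exp (of_int (l1norm k) * s) * of_int (l1norm k) ^ CARD('n)))"
    by (intro Liminf_bounded) (simp add: eventually_inf_principal always_eventually)
  then have "0 < Liminf ?F (\<lambda>k. ereal (cmod (fourier_coeff f k) * exp (of_int (l1norm k) * s) * of_int (l1norm k) ^ CARD('n)))"
    by (rule less_le_trans[rotated]) (simp add: \<delta>(1))
  then show "f \<in> generic_set s"
    using f by (simp add: robust_set_def generic_set_def)
qed

text \<open>
  Rays with \<open>s * l1norm k \<ge> \<sigma>\<^sub>0\<close> are handled simultaneously by dominance of the first harmonic, for every
  \<open>g\<close> whose coefficients at the generators keep half of the lower bound.  The set \<open>K\<close> of remaining rays is finite, and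
  the radius is the minimum of \<open>\<delta> / 2\<close> and half of their stability radii, as \<open>ray_coeffs\<close> doubles the coefficients.
\<close>

lemma robust_set_open:
  fixes f :: "real ^ 'n :: {finite, linorder} \<Rightarrow> real"
  assumes s: "s > 0" and f: "f \<in> robust_set s"
  shows "\<exists>r>0. \<forall>g\<in>unit_ball s. fourier_dist s f g < r \<longrightarrow> g \<in> robust_set s"
proof -
  have ball: "f \<in> unit_ball s" using f by (simp add: robust_set_def)
  obtain \<delta> where \<delta>: "\<delta> > 0"
    "\<And>k. k \<in> generators \<Longrightarrow> \<delta> * exp (- s * of_int (l1norm k)) \<le> cmod (fourier_coeff f k)"
    using f by (auto simp: robust_set_def)
  obtain \<sigma>\<^sub>0 where \<sigma>\<^sub>0: "\<And>\<sigma> c. \<sigma> \<ge> \<sigma>\<^sub>0 \<Longrightarrow> decays \<sigma> 2 c \<Longrightarrow> c 0 = 0 \<Longrightarrow>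
      \<delta> * exp (- \<sigma>) \<le> cmod (c 1) \<Longrightarrow> morse_distinct_values (wave_series 0 c)"
    using morse_wave_series_dominant[OF \<delta>(1), of 2] by auto
  define K where "K = {k \<in> generators :: (int, 'n) vec set. s * of_int (l1norm k) < \<sigma>\<^sub>0}"
  have "K \<subseteq> {k. l1norm k \<le> \<lceil>\<sigma>\<^sub>0 / s\<rceil>}"
  proof
    fix k assume "k \<in> K"
    then have "of_int (l1norm k) < \<sigma>\<^sub>0 / s" using s by (simp add: K_def field_simps)
    then show "k \<in> {k. l1norm k \<le> \<lceil>\<sigma>\<^sub>0 / s\<rceil>}" by simp linarith
  qed
  then have finite: "finite K" by (rule finite_subset[OF _ finite_l1norm_le])
  have "\<exists>r>0. \<forall>d. decays (s * of_int (l1norm k)) r (\<lambda>j. d j - ray_coeffs f k j)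
          \<longrightarrow> morse_distinct_values (wave_series 0 d)" if "k \<in> K" for k
  proof -
    have k: "k \<in> generators" "k \<noteq> 0" using that generators_nonzero by (auto simp: K_def)
    have "morse_distinct_values (wave_series 0 (ray_coeffs f k))"
      using f k by (simp add: robust_set_def flip: ray_projection_eq_wave_series[OF ball s k(2)])
    moreover have "s * of_int (l1norm k) > 0" using s generators_pos[OF k(1)] by simp
    ultimately show ?thesis using morse_wave_series_stable[OF _ decays_ray_coeffs[OF ball]] by blast
  qed
  then obtain \<rho> where \<rho>: "\<And>k. k \<in> K \<Longrightarrow> \<rho> k > (0::real)"
    "\<And>k d. k \<in> K \<Longrightarrow> decays (s * of_int (l1norm k)) (\<rho> k) (\<lambda>j. d j - ray_coeffs f k j)
          \<Longrightarrow> morse_distinct_values (wave_series 0 d)"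
    by metis
  define r where "r = Min (insert (\<delta> / 2) ((\<lambda>k. \<rho> k / 2) ` K))"
  have "r > 0" using finite \<delta>(1) \<rho>(1) by (simp add: r_def)
  moreover have "r \<le> \<delta> / 2" unfolding r_def using finite by (intro Min_le) auto
  moreover have "r \<le> \<rho> k / 2" if "k \<in> K" for k
    unfolding r_def using finite that by (intro Min_le) auto
  ultimately have r: "r > 0" "r \<le> \<delta> / 2" "\<And>k. k \<in> K \<Longrightarrow> r \<le> \<rho> k / 2" by blast+
  have "g \<in> robust_set s" if g: "g \<in> unit_ball s" and dist: "fourier_dist s f g < r" for g
  proof -
    have close: "cmod (fourier_coeff g k - fourier_coeff f k) \<le> r * exp (- s * of_int (l1norm k))" for k
    proof -
      have "cmod (fourier_coeff g k - fourier_coeff f k) \<le> fourier_dist s f g * exp (- s * of_int (l1norm k))"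
        using fourier_coeff_dist[OF unit_ballD(1)[OF ball] unit_ballD(1)[OF g], of k] by (simp add: norm_minus_commute)
      also have "\<dots> \<le> r * exp (- s * of_int (l1norm k))" using dist by (intro mult_right_mono) auto
      finally show ?thesis .
    qed
    have lower: "\<delta> / 2 * exp (- s * of_int (l1norm k)) \<le> cmod (fourier_coeff g k)" if "k \<in> generators" for k
    proof -
      have "r * exp (- s * of_int (l1norm k)) \<le> \<delta> / 2 * exp (- s * of_int (l1norm k))"
        using r(2) by (intro mult_right_mono) auto
      then show ?thesis
        using \<delta>(2)[OF that] close[of k] norm_triangle_ineq2[of "fourier_coeff f k" "fourier_coeff g k"]
          norm_minus_commute[of "fourier_coeff f k" "fourier_coeff g k"]
        by linarith
    qed
    have "morse_distinct_values (ray_projection g k)" if k: "k \<in> generators" for k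
    proof -
      have k0: "k \<noteq> 0" by (rule generators_nonzero[OF k])
      show ?thesis
        unfolding ray_projection_eq_wave_series[OF g s k0]
      proof (cases "k \<in> K")
        case True
        show "morse_distinct_values (wave_series 0 (ray_coeffs g k))"
        proof (rule \<rho>(2)[OF True])
          show "decays (s * of_int (l1norm k)) (\<rho> k) (\<lambda>j. ray_coeffs g k j - ray_coeffs f k j)"
            unfolding decays_def
          proof
            fix j
            have "ray_coeffs g k j - ray_coeffs f k j
                = 2 * (fourier_coeff g (\<chi> i. int j * k $ i) - fourier_coeff f (\<chi> i. int j * k $ i))"
              by (simp add: ray_coeffs_def)
            then have "cmod (ray_coeffs g k j - ray_coeffs f k j)
                = 2 * cmod (fourier_coeff g (\<chi> i. int j * k $ i) - fourier_coeff f (\<chi> i. int j * k $ i))"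
              by (simp only: norm_mult norm_numeral)
            also have "\<dots> \<le> 2 * (r * exp (- s * of_int (l1norm (\<chi> i. int j * k $ i))))"
              by (intro mult_left_mono close) auto
            also have "\<dots> = 2 * r * exp (- (s * of_int (l1norm k)) * real j)"
              by (simp add: l1norm_scale mult_ac)
            also have "\<dots> \<le> \<rho> k * exp (- (s * of_int (l1norm k)) * real j)"
              using r(3)[OF True] by (intro mult_right_mono) auto
            finally show "cmod (ray_coeffs g k j - ray_coeffs f k j) \<le> \<dots>" .
          qed
        qed
      next
        case False
        show "morse_distinct_values (wave_series 0 (ray_coeffs g k))"
        proof (rule \<sigma>\<^sub>0)
          show "\<sigma>\<^sub>0 \<le> s * of_int (l1norm k)" using False k by (auto simp: K_def)
          show "decays (s * of_int (l1norm k)) 2 (ray_coeffs g k)" by (rule decays_ray_coeffs[OF g])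
          show "ray_coeffs g k 0 = 0" by (rule ray_coeffs_0[OF unit_ballD(1)[OF g]])
          show "\<delta> * exp (- (s * of_int (l1norm k))) \<le> cmod (ray_coeffs g k 1)"
            using lower[OF k] by (simp add: ray_coeffs_1[unfolded One_nat_def] norm_mult)
        qed
      qed
    qed
    then show ?thesis
      using g lower \<delta>(1) half_gt_zero unfolding robust_set_def by blast
  qed
  then show ?thesis using r(1) by blast
qed

lemma push_away_from_zero:
  fixes b :: complex
  assumes "r \<ge> 0"
  shows "\<exists>w. cmod w = r \<and> r \<le> cmod (b + w)"
proof (cases "r \<le> cmod (b + of_real r)")
  case True
  then show ?thesis using assms by (intro exI[of _ "of_real r"]) simp
next
  case False
  have "2 * r \<le> cmod (b + of_real r) + cmod (b - of_real r)"
    using norm_triangle_ineq4[of "b + of_real r" "b - of_real r"] assms by simp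
  then show ?thesis using False assms by (intro exI[of _ "- of_real r"]) simp
qed

text \<open>
  The first half of the allowed change moves \<open>c 1\<close> away from zero; the second, of size below \<open>e / 4\<close>, makes the
  sum a Morse function and cannot undo the first.
\<close>

lemma robust_ray_adjustment:
  fixes c :: "nat \<Rightarrow> complex"
  assumes \<sigma>: "\<sigma> > 0" and c: "decays \<sigma> M c" and e: "e > 0"
  shows "\<exists>w. cmod w \<le> e \<and> e / 4 \<le> cmod (c 1 + w) \<and> morse_distinct_values (wave_series 0 (c(1 := c 1 + w)))"
proof -
  obtain u where u: "cmod u = e / 2" "e / 2 \<le> cmod (c 1 + u)"
    using push_away_from_zero[of "e / 2" "c 1"] e by auto
  have "decays \<sigma> (M + e / 2 * exp \<sigma>) (c(1 := c 1 + u))"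
    unfolding decays_def
  proof
    fix j
    have "cmod ((c(1 := c 1 + u)) j) \<le> cmod (c j) + (if j = 1 then e / 2 else 0)"
      using norm_triangle_ineq[of "c 1" u] u(1) by simp
    also have "\<dots> \<le> M * exp (- \<sigma> * real j) + e / 2 * exp \<sigma> * exp (- \<sigma> * real j)"
      using c e unfolding decays_def
      by (intro add_mono) (auto simp: mult.assoc exp_add[symmetric])
    finally show "cmod ((c(1 := c 1 + u)) j) \<le> (M + e / 2 * exp \<sigma>) * exp (- \<sigma> * real j)"
      by (simp add: algebra_simps)
  qed
  then obtain v where v: "cmod v < e / 4"
    "morse_distinct_values (wave_series 0 ((c(1 := c 1 + u))(1 := (c(1 := c 1 + u)) 1 + v)))"
    using morse_wave_series_by_first_coefficient[OF \<sigma>, of _ _ "e / 4"] e by fastforce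
  have "cmod (u + v) \<le> e" using norm_triangle_ineq[of u v] u(1) v(1) e by simp
  moreover have "e / 4 \<le> cmod (c 1 + (u + v))"
    using norm_triangle_ineq2[of "c 1 + u" "- v"] u(2) v(1) by (simp add: add.assoc)
  ultimately show ?thesis
    using v(2) by (intro exI[of _ "u + v"]) (simp add: add.assoc)
qed

text \<open>
  The shrunken coefficients \<open>b k\<close> leave the margin \<open>\<eta> * E k\<close> to the boundary of the ball, which is spent on \<open>W k\<close>.
  The change at \<open>- k\<close> is the conjugate one, to keep the function real.
\<close>

lemma robust_set_dense:
  fixes f :: "real ^ 'n :: {finite, linorder} \<Rightarrow> real"
  assumes s: "s > 0" and f: "f \<in> unit_ball s" and \<epsilon>: "\<epsilon> > 0"
  shows "\<exists>g\<in>robust_set s. fourier_dist s f g < \<epsilon>"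
proof -
  define \<eta> where "\<eta> = min (1/2) (\<epsilon> / 4)"
  have \<eta>: "\<eta> > 0" "\<eta> < 1" "2 * \<eta> < \<epsilon>" using \<epsilon> by (auto simp: \<eta>_def)
  define E where "E k = exp (- s * of_int (l1norm k))" for k :: "(int, 'n) vec"
  have E: "E k > 0" "E (- k) = E k" for k by (simp_all add: E_def)
  define b where "b k = of_real (1 - \<eta>) * fourier_coeff f k" for k
  have b: "cmod (b k) \<le> (1 - \<eta>) * E k" "cmod (b k - fourier_coeff f k) \<le> \<eta> * E k" for k
  proof -
    have fk: "cmod (fourier_coeff f k) \<le> E k" using unit_ballD(2)[OF f, of k] by (simp add: E_def)
    show "cmod (b k) \<le> (1 - \<eta>) * E k"
      using \<eta> fk by (simp only: b_def norm_mult norm_of_real) (intro mult_mono, auto)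
    have "b k - fourier_coeff f k = - (of_real \<eta> * fourier_coeff f k)" by (simp add: b_def algebra_simps)
    then show "cmod (b k - fourier_coeff f k) \<le> \<eta> * E k" using fk \<eta>(1) by (simp add: norm_mult)
  qed
  have b_neg: "b (- k) = cnj (b k)" for k by (simp add: b_def fourier_coeff_neg)
  define ray where "ray k n = 2 * b (\<chi> i. int n * k $ i)" for k and n :: nat
  have ray_1: "ray k 1 = 2 * b k" for k by (simp add: ray_def)
  have "\<exists>w. cmod w \<le> \<eta> * E k \<and> \<eta> / 4 * E k \<le> cmod (b k + w) \<and>
      morse_distinct_values (wave_series 0 ((ray k)(1 := 2 * (b k + w))))" if k: "k \<in> generators" for k
  proof -
    have "decays (s * of_int (l1norm k)) 2 (ray k)"
      unfolding decays_def
    proof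
      fix n
      have "cmod (b (\<chi> i. int n * k $ i)) \<le> 1 * E (\<chi> i. int n * k $ i)"
        by (rule order_trans[OF b(1)]) (use \<eta>(1) E(1) in \<open>auto intro!: mult_right_mono simp: less_imp_le\<close>)
      then show "cmod (ray k n) \<le> 2 * exp (- (s * of_int (l1norm k)) * real n)"
        by (simp add: ray_def norm_mult E_def l1norm_scale mult_ac)
    qed
    moreover have "s * of_int (l1norm k) > 0" using s generators_pos[OF k] by simp
    ultimately obtain w where w: "cmod w \<le> 2 * \<eta> * E k" "2 * \<eta> * E k / 4 \<le> cmod (ray k 1 + w)"
      "morse_distinct_values (wave_series 0 ((ray k)(1 := ray k 1 + w)))"
      using robust_ray_adjustment[of _ 2 "ray k" "2 * \<eta> * E k"] \<eta>(1) E(1)[of k] by auto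
    have sum: "ray k 1 + w = 2 * (b k + w / 2)" by (simp add: ray_1 del: One_nat_def)
    then have double: "cmod (ray k 1 + w) = 2 * cmod (b k + w / 2)"
      by (simp only: norm_mult norm_numeral)
    show ?thesis
    proof (intro exI[of _ "w / 2"] conjI)
      show "cmod (w / 2) \<le> \<eta> * E k" using w(1) by (simp add: norm_divide)
      show "\<eta> / 4 * E k \<le> cmod (b k + w / 2)" using w(2) unfolding double by simp
      show "morse_distinct_values (wave_series 0 ((ray k)(1 := 2 * (b k + w / 2))))"
        using w(3) unfolding sum .
    qed
  qed
  then obtain W where W: "\<And>k. k \<in> generators \<Longrightarrow> cmod (W k) \<le> \<eta> * E k"
    "\<And>k. k \<in> generators \<Longrightarrow> \<eta> / 4 * E k \<le> cmod (b k + W k)"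
    "\<And>k. k \<in> generators \<Longrightarrow> morse_distinct_values (wave_series 0 ((ray k)(1 := 2 * (b k + W k))))"
    by metis
  define w where "w k = (if k \<in> generators then W k else if - k \<in> generators then cnj (W (- k)) else 0)" for k
  define c where "c k = b k + w k" for k
  have w: "cmod (w k) \<le> \<eta> * E k" for k
    using W(1)[of k] W(1)[of "- k"] \<eta>(1) E(1)[of k] E(2)[of k] by (auto simp: w_def)
  have c_neg: "c (- k) = cnj (c k)" for k
    using generators_minus[of k] by (auto simp: c_def b_neg w_def)
  have c_E: "cmod (c k) \<le> E k" for k
    using norm_triangle_ineq[of "b k" "w k"] b(1)[of k] w[of k] by (simp add: c_def algebra_simps)
  have c_bound: "cmod (c k) \<le> 1 * exp (- s * of_int (l1norm k))" for k
    using c_E[of k] by (simp add: E_def)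
  have c_zero: "c 0 = 0"
    using fourier_coeff_zero[OF unit_ballD(1)[OF f]] generators_nonzero[of 0]
    by (auto simp: c_def b_def w_def)
  define g where "g = fourier_synthesis c"
  have coeff: "fourier_coeff g k = c k" for k
    unfolding g_def by (rule fourier_coeff_fourier_synthesis[OF s c_bound c_neg])
  have "g \<in> analytic_space s"
    unfolding g_def by (rule fourier_synthesis_in_analytic_space[OF s c_bound c_neg c_zero])
  then have g: "g \<in> unit_ball s" using c_bound by (simp add: unit_ball_iff coeff)
  have "fourier_dist s f g \<le> 2 * \<eta>"
  proof (rule fourier_dist_le[OF unit_ballD(1)[OF f] unit_ballD(1)[OF g]])
    fix k
    have "cmod (fourier_coeff f k - fourier_coeff g k) = cmod ((b k - fourier_coeff f k) + w k)"
      by (subst norm_minus_commute) (simp add: coeff c_def algebra_simps)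
    also have "\<dots> \<le> \<eta> * E k + \<eta> * E k"
      by (rule norm_triangle_le[OF add_mono[OF b(2) w]])
    finally show "cmod (fourier_coeff f k - fourier_coeff g k) \<le> 2 * \<eta> * exp (- s * of_int (l1norm k))"
      by (simp add: E_def)
  qed (use \<eta> in simp)
  then have "fourier_dist s f g < \<epsilon>" using \<eta>(3) by simp
  moreover have "g \<in> robust_set s"
    unfolding robust_set_def
  proof (intro CollectI conjI exI[of _ "\<eta> / 4"] ballI)
    show "\<eta> / 4 > 0" using \<eta>(1) by simp
    fix k :: "(int, 'n) vec" assume k: "k \<in> generators"
    show "\<eta> / 4 * exp (- s * of_int (l1norm k)) \<le> cmod (fourier_coeff g k)"
      using W(2)[OF k] k by (simp add: coeff c_def w_def E_def)
    have "ray_coeffs g k = (ray k)(1 := 2 * (b k + W k))"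
    proof
      fix n
      show "ray_coeffs g k n = ((ray k)(1 := 2 * (b k + W k))) n"
      proof (cases "n = 1")
        case True
        then show ?thesis using k by (simp add: ray_coeffs_def coeff c_def w_def)
      next
        case False
        then have "w (\<chi> i. int n * k $ i) = 0"
          using generators_multiple[of "int n" k] by (simp add: w_def)
        then show ?thesis using False by (simp add: ray_coeffs_def coeff c_def ray_def)
      qed
    qed
    then show "morse_distinct_values (ray_projection g k)"
      using W(3)[OF k] ray_projection_eq_wave_series[OF g s generators_nonzero[OF k]] by simp
  qed (rule g)
  ultimately show ?thesis by blast
qed

theorem proposition1p3:
  fixes s :: real
  assumes "s > 0"
  shows "\<exists>U :: (real ^ 'n :: {finite, linorder} \<Rightarrow> real) set.
           U \<subseteq> generic_set s \<and>
           openin (subtopology (norm_topology s) (unit_ball s)) U \<and>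
           (subtopology (norm_topology s) (unit_ball s)) closure_of U = unit_ball s"
proof (intro exI[of _ "robust_set s"] conjI)
  show "robust_set s \<subseteq> (generic_set s :: ((real, 'n) vec \<Rightarrow> real) set)"
    by (rule robust_set_subset_generic_set)
  interpret Metric_space "analytic_space s :: ((real, 'n) vec \<Rightarrow> real) set" "fourier_dist s"
    by (rule Metric_space_analytic_space)
  have sub: "robust_set s \<subseteq> (unit_ball s :: ((real, 'n) vec \<Rightarrow> real) set)"
    by (auto simp: robust_set_def)
  have ball: "(unit_ball s :: ((real, 'n) vec \<Rightarrow> real) set) \<subseteq> analytic_space s"
    by (auto simp: unit_ball_def)
  have "\<forall>f\<in>robust_set s. \<exists>r>0. \<forall>g\<in>unit_ball s. fourier_dist s f g < r \<longrightarrow> g \<in> (robust_set s :: ((real, 'n) vec \<Rightarrow> real) set)"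
    using robust_set_open[OF assms] by blast
  then obtain r :: "((real, 'n) vec \<Rightarrow> real) \<Rightarrow> real" where r: "\<And>f. f \<in> robust_set s \<Longrightarrow> r f > 0"
    "\<And>f g. f \<in> robust_set s \<Longrightarrow> g \<in> unit_ball s \<Longrightarrow> fourier_dist s f g < r f \<Longrightarrow> g \<in> robust_set s"
    using bchoice[of "robust_set s"] by (metis (no_types, lifting))
  define V where "V = (\<Union>f\<in>robust_set s. mball f (r f))"
  have "openin mtopology V" unfolding V_def by auto
  moreover have "robust_set s = V \<inter> unit_ball s"
  proof
    show "robust_set s \<subseteq> V \<inter> unit_ball s"
      unfolding V_def using r(1) sub ball centre_in_mball_iff by blast
    show "V \<inter> unit_ball s \<subseteq> robust_set s"
      unfolding V_def using r(2) by auto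
  qed
  ultimately show "openin (subtopology (norm_topology s) (unit_ball s)) (robust_set s :: ((real, 'n) vec \<Rightarrow> real) set)"
    unfolding norm_topology_def openin_subtopology by blast
  have "\<exists>g\<in>robust_set s. g \<in> mball f e" if "f \<in> unit_ball s" "e > 0" for f e
    using robust_set_dense[OF assms that] that(1) sub ball unfolding in_mball by blast
  then show "subtopology (norm_topology s) (unit_ball s) closure_of (robust_set s)
      = (unit_ball s :: ((real, 'n) vec \<Rightarrow> real) set)"
    unfolding norm_topology_def closure_of_subtopology metric_closure_of Int_absorb1[OF sub]
    using ball by blast
qed

end
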